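(* For every $u_h,v_h\in V_h^0$ and every $T\in\mathcal T_h$, $$|\xi_T(u_h)-\xi_T(v_h)|\le \widehat L_T\,\|u_h-v_h\|_{1,T},\qquad \widehat L_T:=\chi_T\frac{\mu(h_T)}{\tau}(a_T+q_T).$$ Consequently, for every $u_{hb},v_{hb}\in V_{hb}^0$ and every $T\in\mathcal T_h$, $$|\xi_T(\kappa_h(u_{hb}))-\xi_T(\kappa_h(v_{hb}))|\le L_T\,\|u_{hb}-v_{hb}\|_{1,T},\qquad L_T:=C_{\kappa,1}\widehat L_T=\chi_T\frac{\mu(h_T)}{\tau}C_{\kappa,1}(a_T+q_T).$$ Moreover, for fixed problem data and fixed $\tau>0$, there exists a constant $C_L>0$, independent of $h$, such that $L_T\le C_Lh_T$ for all $T\in\mathcal T_h$. When $\sigma=0$, the two Lipschitz estimates can be sharpened to $$|\xi_T(u_h)-\xi_T(v_h)|\le L_T^0\,|u_h-v_h|_{1,T}\quad\text{for all }u_h,v_h\in V_h^0,$$ and $$|\xi_T(\kappa_h(u_{hb}))-\xi_T(\kappa_h(v_{hb}))|\le L_T^0\,|u_{hb}-v_{hb}|_{1,T}\quad\text{for all }u_{hb},v_{hb}\in V_{hb}^0,$$ respectively, where $$L_T^0:=\chi_T\frac{\mu(h_T)}{\tau}\left(\|\boldsymbol\beta\|_{0,\infty,T}+q_T\right),$$ and there also exists a constant $C_L^0>0$, independent of $h$, such that $L_T^0\le C_L^0h_T$ for all $T\in\mathcal T_h$.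
   Context: Data. $\Omega\subset\mathbb R^d$, $d\in\{2,3\}$, is a bounded polygonal ($d=2$) or polyhedral ($d=3$) domain with Lipschitz boundary; $\varepsilon>0$, $\boldsymbol\beta\in[W^{1,\infty}(\Omega)]^d$ with $\nabla\cdot\boldsymbol\beta=0$, $\sigma\ge 0$ a constant, and $f\in L^2(\Omega)$ ("problem data"). $\|\cdot\|_{0,T}$ is the $L^2(T)$ norm, $|v|_{1,T}=\|\nabla v\|_{0,T}$, $\|v\|_{1,T}^2=\|v\|_{0,T}^2+|v|_{1,T}^2$; omitting $T$ means the norm over $\Omega$. $\|\boldsymbol\beta\|_{0,\infty,T}$ is the essential supremum over $T$ of the Euclidean norm of $\boldsymbol\beta$. Discrete spaces. $\mathcal T_h$ is a conforming triangulation of $\Omega$ into simplices $T$, from a shape-regular family; $h_T=\operatorname{diam}(T)$, $h=\max_T h_T$. $V_h^0=\{v\in H_0^1(\Omega): v|_T\in\mathbb P_1(T)\ \forall T\in\mathcal T_h\}$; $V_b=\bigoplus_{T}\operatorname{span}\{\psi_T\}$, where $\psi_T\in H_0^1(T)$ is the standard simplex bubble of degree $d+1$ (product of the barycentric coordinates of $T$, up to scaling), extended by zero; $V_{hb}^0=V_h^0\oplus V_b$. $\kappa_h:V_{hb}^0\to V_h^0$ is the projection $\kappa_h(v_h+v_b)=v_h$ for $v_h\in V_h^0$, $v_b\in V_b$. It is $L^2$-stable: there is $C_\kappa>0$ independent of $h$ with $\|\kappa_h(v_{hb})\|_{0,T}\le C_\kappa\|v_{hb}\|_{0,T}$ for all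 $v_{hb}\in V_{hb}^0$, $T\in\mathcal T_h$. Set $C_{\kappa,1}:=\max\{C_\kappa,1\}$. Artificial diffusivity. For $v_h\in V_h^0$, $R_T(v_h)=\boldsymbol\beta\cdot\nabla v_h+\sigma v_h-f$ on $T$. $Pe_T=\|\boldsymbol\beta\|_{0,\infty,T}h_T/(2\varepsilon)$; $\chi_T=1$ if $Pe_T>1$ and $\chi_T=0$ if $Pe_T\le1$. Fix $\tau>0$ and numbers $\mu(h_T)>0$ with $\mu(h_T)\le C_\mu h_T$, $C_\mu$ independent of $h$. Let $\mathcal N_T(v_h)=\|v_h\|_{1,T}$ if $\sigma>0$ and $\mathcal N_T(v_h)=|v_h|_{1,T}$ if $\sigma=0$. Then $$\xi_T(v_h)=\chi_T\,\mu(h_T)\frac{\|R_T(v_h)\|_{0,T}}{\mathcal N_T(v_h)+\tau}.$$ Constants: $a_T=(\|\boldsymbol\beta\|_{0,\infty,T}^2+\sigma^2)^{1/2}$; $q_T=\|\boldsymbol\beta\|_{0,\infty,T}+\sigma+\tau^{-1}\|f\|_{0,T}$ (for $\sigma=0$ the term $\sigma$ is absent). "Independent of $h$" means the same constant works for all meshes of the family. *)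

theory Defs
  imports "HOL-Analysis.Analysis" "HOL-Probability.Essential_Supremum"
begin

section \<open>Domains and triangulations\<close>

text \<open>
  Near each boundary point, in a direction \<open>e\<close> depending on the point, the set lies strictly below
  the graph of a Lipschitz function of the coordinates orthogonal to \<open>e\<close>. A Lipschitz function on
  that hyperplane extends to the whole space, so \<open>\<gamma>\<close> is taken globally Lipschitz and
  evaluated at orthogonal projections only.
\<close>
definition lipschitz_boundary :: "'a::euclidean_space set \<Rightarrow> bool" where
  "lipschitz_boundary \<Omega> \<longleftrightarrow>
     (\<forall>x\<in>frontier \<Omega>. \<exists>e r K. \<exists>\<gamma>::'a \<Rightarrow> real. norm e = 1 \<and> r > 0 \<and> K-lipschitz_on UNIV \<gamma> \<and>
        (\<forall>y\<in>ball x r. y \<in> \<Omega> \<longleftrightarrow> y \<bullet> e < \<gamma> (y - (y \<bullet> e) *\<^sub>R e)))"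

definition polyhedral_boundary :: "'a::euclidean_space set \<Rightarrow> bool" where
  "polyhedral_boundary \<Omega> \<longleftrightarrow>
     (\<exists>F. finite F \<and> (\<forall>P\<in>F. polytope P \<and> aff_dim P = int DIM('a) - 1) \<and> frontier \<Omega> = \<Union>F)"

definition polyhedral_lipschitz_domain :: "'a::euclidean_space set \<Rightarrow> bool" where
  "polyhedral_lipschitz_domain \<Omega> \<longleftrightarrow>
     open \<Omega> \<and> connected \<Omega> \<and> \<Omega> \<noteq> {} \<and> bounded \<Omega> \<and> polyhedral_boundary \<Omega> \<and> lipschitz_boundary \<Omega>"

text \<open>
  Conformity, i.e. that two elements meet in a common (possibly empty) face, is part of the
  library's \<^const>\<open>triangulation\<close>. The elements are closed simplices.
\<close>
definition conforming_triangulation :: "'a::euclidean_space set \<Rightarrow> 'a set set \<Rightarrow> bool" where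
  "conforming_triangulation \<Omega> \<T> \<longleftrightarrow>
     triangulation \<T> \<and> (\<forall>T\<in>\<T>. int DIM('a) simplex T) \<and> \<Union>\<T> = closure \<Omega>"

definition inball_diameter :: "'a::euclidean_space set \<Rightarrow> real" where
  "inball_diameter T = Sup {2 * r |r x. 0 \<le> r \<and> cball x r \<subseteq> T}"

definition shape_regular :: "'a::euclidean_space set set set \<Rightarrow> bool" where
  "shape_regular \<TT> \<longleftrightarrow>
     (\<exists>\<gamma>>0. \<forall>\<T>\<in>\<TT>. \<forall>T\<in>\<T>. diameter T \<le> \<gamma> * inball_diameter T)"

section \<open>Test functions, weak gradients and Sobolev spaces\<close>

definition partial_deriv :: "'a::euclidean_space \<Rightarrow> ('a \<Rightarrow> real) \<Rightarrow> 'a \<Rightarrow> real" where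
  "partial_deriv i \<phi> x = frechet_derivative \<phi> (at x) i"

fun C_k :: "nat \<Rightarrow> ('a::euclidean_space \<Rightarrow> real) \<Rightarrow> bool" where
  "C_k 0 \<phi> \<longleftrightarrow> continuous_on UNIV \<phi>"
| "C_k (Suc k) \<phi> \<longleftrightarrow>
     (\<forall>x. \<phi> differentiable (at x)) \<and> (\<forall>i\<in>Basis. C_k k (partial_deriv i \<phi>))"

definition test_functions :: "'a::euclidean_space set \<Rightarrow> ('a \<Rightarrow> real) set" where
  "test_functions U =
     {\<phi>. (\<forall>k. C_k k \<phi>) \<and> compact (closure {x. \<phi> x \<noteq> 0}) \<and> closure {x. \<phi> x \<noteq> 0} \<subseteq> U}"

text \<open>
  Functions on a subset of the space are represented by total functions; their values outside
  the set are irrelevant. Integrals use the completed Lebesgue measure, so that values on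
  null sets (such as the boundary of a simplex) affect neither measurability nor norms.
\<close>

definition locally_integrable :: "'a::euclidean_space set \<Rightarrow> ('a \<Rightarrow> 'b::euclidean_space) \<Rightarrow> bool" where
  "locally_integrable U v \<longleftrightarrow> (\<forall>K. compact K \<and> K \<subseteq> U \<longrightarrow> integrable (lebesgue_on K) v)"

definition has_weak_gradient ::
  "'a::euclidean_space set \<Rightarrow> ('a \<Rightarrow> real) \<Rightarrow> ('a \<Rightarrow> 'a) \<Rightarrow> bool" where
  "has_weak_gradient U v g \<longleftrightarrow>
     locally_integrable U v \<and> locally_integrable U g \<and>
     (\<forall>\<phi>\<in>test_functions U. \<forall>i\<in>Basis.
        (LINT x|lebesgue_on U. v x * partial_deriv i \<phi> x) = - (LINT x|lebesgue_on U. (g x \<bullet> i) * \<phi> x))"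

text \<open>Weak gradients are unique up to null sets only; this selects a representative.\<close>
definition weak_grad :: "'a::euclidean_space set \<Rightarrow> ('a \<Rightarrow> real) \<Rightarrow> 'a \<Rightarrow> 'a" where
  "weak_grad U v = (SOME g. has_weak_gradient U v g)"

definition L2 :: "'a::euclidean_space set \<Rightarrow> ('a \<Rightarrow> 'b::euclidean_space) set" where
  "L2 S = {v. v \<in> borel_measurable (lebesgue_on S) \<and> integrable (lebesgue_on S) (\<lambda>x. (norm (v x))\<^sup>2)}"

definition L2_norm :: "'a::euclidean_space set \<Rightarrow> ('a \<Rightarrow> 'b::euclidean_space) \<Rightarrow> real" where
  "L2_norm S v = sqrt (LINT x|lebesgue_on S. (norm (v x))\<^sup>2)"

text \<open>
  The set \<open>S\<close> is either open or a closed simplex; in the latter case the gradient is that of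
  the function on the open simplex.
\<close>
definition H1_seminorm :: "'a::euclidean_space set \<Rightarrow> ('a \<Rightarrow> real) \<Rightarrow> real" where
  "H1_seminorm S v = L2_norm S (weak_grad (interior S) v)"

definition H1_norm :: "'a::euclidean_space set \<Rightarrow> ('a \<Rightarrow> real) \<Rightarrow> real" where
  "H1_norm S v = sqrt ((L2_norm S v)\<^sup>2 + (H1_seminorm S v)\<^sup>2)"

definition H1 :: "'a::euclidean_space set \<Rightarrow> ('a \<Rightarrow> real) set" where
  "H1 U = {v \<in> L2 U. \<exists>g\<in>L2 U. has_weak_gradient U v g}"

definition H10 :: "'a::euclidean_space set \<Rightarrow> ('a \<Rightarrow> real) set" where
  "H10 U = {v \<in> H1 U. \<exists>\<phi>. (\<forall>n::nat. \<phi> n \<in> test_functions U) \<and>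
              (\<lambda>n. H1_norm U (\<lambda>x. v x - \<phi> n x)) \<longlonglongrightarrow> 0}"

definition Linfty :: "'a::euclidean_space set \<Rightarrow> ('a \<Rightarrow> 'b::euclidean_space) set" where
  "Linfty S = {v. v \<in> borel_measurable (lebesgue_on S) \<and> (\<exists>C. AE x in lebesgue_on S. norm (v x) \<le> C)}"

definition Linfty_norm :: "'a::euclidean_space set \<Rightarrow> ('a \<Rightarrow> 'b::euclidean_space) \<Rightarrow> real" where
  "Linfty_norm S v = real_of_ereal (esssup (lebesgue_on S) (\<lambda>x. ereal (norm (v x))))"

definition W1_infty :: "'a::euclidean_space set \<Rightarrow> ('a \<Rightarrow> real) set" where
  "W1_infty U = {v \<in> Linfty U. \<exists>g\<in>Linfty U. has_weak_gradient U v g}"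

definition W1_infty_field :: "'a::euclidean_space set \<Rightarrow> ('a \<Rightarrow> 'a) set" where
  "W1_infty_field U = {\<beta>. \<forall>i\<in>Basis. (\<lambda>x. \<beta> x \<bullet> i) \<in> W1_infty U}"

definition weak_divergence :: "'a::euclidean_space set \<Rightarrow> ('a \<Rightarrow> 'a) \<Rightarrow> 'a \<Rightarrow> real" where
  "weak_divergence U \<beta> x = (\<Sum>i\<in>Basis. weak_grad U (\<lambda>y. \<beta> y \<bullet> i) x \<bullet> i)"

section \<open>Discrete spaces\<close>

definition P1 :: "'a::euclidean_space set \<Rightarrow> ('a \<Rightarrow> real) set" where
  "P1 T = {v. \<exists>a b. \<forall>x\<in>T. v x = a \<bullet> x + b}"

text \<open>
  Discrete functions are represented by their continuous representative on the closure of the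
  domain: they are affine on every closed element.
\<close>
definition Vh0 :: "'a::euclidean_space set \<Rightarrow> 'a set set \<Rightarrow> ('a \<Rightarrow> real) set" where
  "Vh0 \<Omega> \<T> = {v \<in> H10 \<Omega>. \<forall>T\<in>\<T>. v \<in> P1 T}"

definition vertices :: "'a::euclidean_space set \<Rightarrow> 'a set" where
  "vertices T = {a. a extreme_point_of T}"

definition barycentric :: "'a::euclidean_space set \<Rightarrow> 'a \<Rightarrow> 'a \<Rightarrow> real" where
  "barycentric T a x =
     (THE l. (\<forall>w. w \<notin> vertices T \<longrightarrow> l w = 0) \<and> (\<Sum>w\<in>vertices T. l w) = 1 \<and>
             (\<Sum>w\<in>vertices T. l w *\<^sub>R w) = x) a"

definition bubble :: "'a::euclidean_space set \<Rightarrow> 'a \<Rightarrow> real" where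
  "bubble T x = (if x \<in> T then \<Prod>a\<in>vertices T. barycentric T a x else 0)"

definition Vb :: "'a::euclidean_space set set \<Rightarrow> ('a \<Rightarrow> real) set" where
  "Vb \<T> = {(\<lambda>x. \<Sum>T\<in>\<T>. c T * bubble T x) |c. True}"

definition Vhb0 :: "'a::euclidean_space set \<Rightarrow> 'a set set \<Rightarrow> ('a \<Rightarrow> real) set" where
  "Vhb0 \<Omega> \<T> = {(\<lambda>x. vh x + vb x) |vh vb. vh \<in> Vh0 \<Omega> \<T> \<and> vb \<in> Vb \<T>}"

definition kappa :: "'a::euclidean_space set \<Rightarrow> 'a set set \<Rightarrow> ('a \<Rightarrow> real) \<Rightarrow> ('a \<Rightarrow> real)" where
  "kappa \<Omega> \<T> v = (THE vh. vh \<in> Vh0 \<Omega> \<T> \<and> (\<exists>vb\<in>Vb \<T>. v = (\<lambda>x. vh x + vb x)))"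

section \<open>Artificial diffusivity\<close>

definition residual ::
  "('a::euclidean_space \<Rightarrow> 'a) \<Rightarrow> real \<Rightarrow> ('a \<Rightarrow> real) \<Rightarrow> 'a set \<Rightarrow> ('a \<Rightarrow> real) \<Rightarrow> 'a \<Rightarrow> real" where
  "residual \<beta> \<sigma> f T v x = \<beta> x \<bullet> weak_grad (interior T) v x + \<sigma> * v x - f x"

definition Peclet :: "real \<Rightarrow> ('a::euclidean_space \<Rightarrow> 'a) \<Rightarrow> 'a set \<Rightarrow> real" where
  "Peclet \<epsilon> \<beta> T = Linfty_norm T \<beta> * diameter T / (2 * \<epsilon>)"

definition chi :: "real \<Rightarrow> ('a::euclidean_space \<Rightarrow> 'a) \<Rightarrow> 'a set \<Rightarrow> real" where
  "chi \<epsilon> \<beta> T = (if Peclet \<epsilon> \<beta> T > 1 then 1 else 0)"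

definition elem_norm :: "real \<Rightarrow> 'a::euclidean_space set \<Rightarrow> ('a \<Rightarrow> real) \<Rightarrow> real" where
  "elem_norm \<sigma> T v = (if \<sigma> > 0 then H1_norm T v else H1_seminorm T v)"

definition xi ::
  "real \<Rightarrow> ('a::euclidean_space \<Rightarrow> 'a) \<Rightarrow> real \<Rightarrow> ('a \<Rightarrow> real) \<Rightarrow> (real \<Rightarrow> real) \<Rightarrow> real \<Rightarrow>
   'a set \<Rightarrow> ('a \<Rightarrow> real) \<Rightarrow> real" where
  "xi \<epsilon> \<beta> \<sigma> f \<mu> \<tau> T v =
     chi \<epsilon> \<beta> T * \<mu> (diameter T) * (L2_norm T (residual \<beta> \<sigma> f T v) / (elem_norm \<sigma> T v + \<tau>))"

definition a_const :: "('a::euclidean_space \<Rightarrow> 'a) \<Rightarrow> real \<Rightarrow> 'a set \<Rightarrow> real" where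
  "a_const \<beta> \<sigma> T = sqrt ((Linfty_norm T \<beta>)\<^sup>2 + \<sigma>\<^sup>2)"

definition q_const ::
  "('a::euclidean_space \<Rightarrow> 'a) \<Rightarrow> real \<Rightarrow> ('a \<Rightarrow> real) \<Rightarrow> real \<Rightarrow> 'a set \<Rightarrow> real" where
  "q_const \<beta> \<sigma> f \<tau> T = Linfty_norm T \<beta> + \<sigma> + inverse \<tau> * L2_norm T f"

definition L_hat ::
  "real \<Rightarrow> ('a::euclidean_space \<Rightarrow> 'a) \<Rightarrow> real \<Rightarrow> ('a \<Rightarrow> real) \<Rightarrow> (real \<Rightarrow> real) \<Rightarrow> real \<Rightarrow>
   'a set \<Rightarrow> real" where
  "L_hat \<epsilon> \<beta> \<sigma> f \<mu> \<tau> T =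
     chi \<epsilon> \<beta> T * (\<mu> (diameter T) / \<tau>) * (a_const \<beta> \<sigma> T + q_const \<beta> \<sigma> f \<tau> T)"

definition L_kappa ::
  "real \<Rightarrow> ('a::euclidean_space \<Rightarrow> 'a) \<Rightarrow> real \<Rightarrow> ('a \<Rightarrow> real) \<Rightarrow> (real \<Rightarrow> real) \<Rightarrow> real \<Rightarrow> real \<Rightarrow>
   'a set \<Rightarrow> real" where
  "L_kappa \<epsilon> \<beta> \<sigma> f \<mu> \<tau> C\<^sub>\<kappa> T = max C\<^sub>\<kappa> 1 * L_hat \<epsilon> \<beta> \<sigma> f \<mu> \<tau> T"

definition L_zero ::
  "real \<Rightarrow> ('a::euclidean_space \<Rightarrow> 'a) \<Rightarrow> real \<Rightarrow> ('a \<Rightarrow> real) \<Rightarrow> (real \<Rightarrow> real) \<Rightarrow> real \<Rightarrow>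
   'a set \<Rightarrow> real" where
  "L_zero \<epsilon> \<beta> \<sigma> f \<mu> \<tau> T =
     chi \<epsilon> \<beta> T * (\<mu> (diameter T) / \<tau>) * (Linfty_norm T \<beta> + q_const \<beta> \<sigma> f \<tau> T)"

end

theory Submission
  imports Defs "HOL-Computational_Algebra.Polynomial"
begin

text \<open>
  On one element write \<open>\<rho>(v)\<close> for the norm of the residual and \<open>\<nu>(v)\<close> for the norm in the denominator.
  The residual is affine in \<open>v\<close>, so \<open>\<rho>\<close> is Lipschitz with constant \<open>a\<^sub>T\<close> with respect to \<open>\<nu>\<close>
  (Cauchy-Schwarz in the plane), and it grows at most linearly: \<open>\<rho>(v) \<le> q\<^sub>T (\<nu>(v) + \<tau>)\<close>, because the part of the
  residual that comes from \<open>f\<close> is absorbed by \<open>\<tau>\<close>. Splitting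
  \<open>\<rho>(u)/(\<nu>(u)+\<tau>) - \<rho>(v)/(\<nu>(v)+\<tau>)\<close> into a change of the numerator and a change of the denominator
  bounds it by \<open>(a\<^sub>T + q\<^sub>T) \<nu>(u - v) / \<tau>\<close>; these steps are \<open>residual_Lipschitz\<close>, \<open>residual_bound\<close> and
  \<open>quotient_Lipschitz\<close>, combined in \<open>xi_Lipschitz\<close>. For \<open>\<sigma> = 0\<close> the norm \<open>\<nu>\<close> is the seminorm and \<open>a\<^sub>T\<close> equals
  \<open>\<parallel>\<beta>\<parallel>\<close>, so the sharpened estimate is the same inequality.

  The estimates on the bubble-enriched space need that \<open>\<kappa>\<^sub>h\<close> does not increase the gradient norm on an element.
  A discrete function has a constant gradient on the element, and the gradient of the bubble has mean value zero
  because the bubble vanishes on the boundary. The two gradients are therefore orthogonal in the mean, and adding a multiple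
  of the bubble can only increase the norm (\<open>H1_seminorm_affine_le_add_bubble\<close>). Together with the
  stability of \<open>\<kappa>\<^sub>h\<close> in the \<open>L\<^sup>2\<close> norm this gives the factor \<open>max C\<^sub>\<kappa> 1\<close>. Stability is applied to a
  difference of two enriched functions, which requires that \<open>H\<^sub>0\<^sup>1\<close> is closed under differences (\<open>H10_diff\<close>) and that
  the splitting into a discrete function and bubbles is unique (\<open>Vhb0_decomposition_unique\<close>): an affine
  function that is a multiple of the bubble vanishes at the vertices, hence everywhere.

  All these norms are built from a chosen weak gradient, so the computations depend on two facts: weak
  gradients are unique up to null sets (\<open>weak_gradient_unique\<close>), and a classical continuous gradient is a
  weak one (\<open>has_weak_gradient_classical\<close>). The first is the fundamental lemma of the calculus of variations; it is
  proved with explicit smooth cutoffs of boxes, built from \<open>exp (- 1 / t)\<close>. The second and the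
  mean-value property of the bubble gradient are both instances of one principle: the integral of a directional derivative of a
  compactly supported Lipschitz function is zero, since difference quotients have integral zero by
  translation invariance and converge dominatedly (\<open>integral_directional_derivative_eq_0\<close>).
\<close>

section \<open>Smooth cutoffs of boxes\<close>

lemma partial_deriv_eqI:
  "(f has_derivative D) (at x) \<Longrightarrow> partial_deriv i f x = D i"
  unfolding partial_deriv_def by (metis frechet_derivative_at)

text \<open>
  The definition of smoothness counts derivatives and demands continuity of the last one only; the product rule needs
  that the orders are nested.
\<close>
lemma C_k_Suc_D: "C_k (Suc k) f \<Longrightarrow> C_k k f"
proof (induction k arbitrary: f)
  case 0
  then show ?case
    by (auto intro!: differentiable_imp_continuous_on simp: differentiable_on_def)
next
  case (Suc k)
  then show ?case by (metis C_k.simps(2))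
qed

lemma C_k_const: "C_k k (\<lambda>x::'a::euclidean_space. c)"
proof (induction k arbitrary: c)
  case (Suc k)
  have "partial_deriv i (\<lambda>x::'a. c) = (\<lambda>x. 0)" for i
    by (rule ext) (rule partial_deriv_eqI, rule has_derivative_const)
  then show ?case using Suc by simp
qed simp

lemma C_k_add: "C_k k f \<Longrightarrow> C_k k g \<Longrightarrow> C_k k (\<lambda>x. f x + g x)"
proof (induction k arbitrary: f g)
  case (Suc k)
  have d: "f differentiable (at x)" "g differentiable (at x)" for x using Suc.prems by auto
  have "partial_deriv i (\<lambda>x. f x + g x) = (\<lambda>x. partial_deriv i f x + partial_deriv i g x)" for i
    using partial_deriv_eqI[OF has_derivative_add[OF d[unfolded frechet_derivative_works]]]
    by (auto simp: partial_deriv_def)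
  then show ?case using Suc d by auto
qed (auto intro: continuous_intros)

lemma C_k_mult: "C_k k f \<Longrightarrow> C_k k g \<Longrightarrow> C_k k (\<lambda>x. f x * g x)"
proof (induction k arbitrary: f g)
  case (Suc k)
  have d: "f differentiable (at x)" "g differentiable (at x)" for x using Suc.prems by auto
  have "partial_deriv i (\<lambda>x. f x * g x) = (\<lambda>x. f x * partial_deriv i g x + partial_deriv i f x * g x)" for i
    using partial_deriv_eqI[OF has_derivative_mult[OF d[unfolded frechet_derivative_works]]]
    by (auto simp: partial_deriv_def)
  moreover have "C_k k f" "C_k k g" using Suc.prems C_k_Suc_D by blast+
  ultimately show ?case using Suc d by (auto intro!: C_k_add)
qed (auto intro: continuous_intros)

lemma C_k_diff: "C_k k f \<Longrightarrow> C_k k g \<Longrightarrow> C_k k (\<lambda>x. f x - g x)"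
  using C_k_add[of k f "\<lambda>x. (- 1) * g x"] C_k_mult[of k "\<lambda>x. - 1" g, OF C_k_const] by simp

lemma C_k_prod: "(\<And>i. i \<in> I \<Longrightarrow> C_k k (f i)) \<Longrightarrow> C_k k (\<lambda>x. \<Prod>i\<in>I. f i x)"
  by (induction I rule: infinite_finite_induct) (auto intro: C_k_const C_k_mult)

text \<open>
  A family of functions on the line, each the derivative of its predecessor, is smooth after composition with an
  affine function of one coordinate: each partial derivative moves one step along the family and multiplies by
  a constant.
\<close>
lemma C_k_compose_coordinate:
  assumes "\<And>n t. (D n has_field_derivative D (Suc n) t) (at t)"
  shows "C_k k (\<lambda>x::'a::euclidean_space. D n (c * (x \<bullet> i) + d))"
proof (induction k arbitrary: n)
  case 0
  have "continuous_on UNIV (D n)"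
    using assms by (meson DERIV_continuous_on has_field_derivative_at_within)
  then show ?case
    by (auto intro!: continuous_on_compose2[of UNIV "D n"] continuous_intros)
next
  case (Suc k)
  have der: "((\<lambda>x::'a. D n (c * (x \<bullet> i) + d)) has_derivative
      (\<lambda>h. D (Suc n) (c * (x \<bullet> i) + d) * (c * (h \<bullet> i)))) (at x)" for x
  proof -
    have 1: "(D n has_derivative (*) (D (Suc n) (c * (x \<bullet> i) + d))) (at (c * (x \<bullet> i) + d))"
      using assms by (simp add: has_field_derivative_def)
    have 2: "((\<lambda>x::'a. c * (x \<bullet> i) + d) has_derivative (\<lambda>h. c * (h \<bullet> i))) (at x)"
      by (auto intro!: derivative_eq_intros)
    show ?thesis using has_derivative_compose[OF 2 1] by simp
  qed
  have "partial_deriv j (\<lambda>x::'a. D n (c * (x \<bullet> i) + d))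
      = (\<lambda>x. D (Suc n) (c * (x \<bullet> i) + d) * (c * (j \<bullet> i)))" for j
    by (rule ext) (rule partial_deriv_eqI[OF der])
  then show ?case using der Suc by (auto intro!: C_k_mult C_k_const simp: differentiable_def)
qed

definition flat_exp :: "real \<Rightarrow> real" where
  "flat_exp t = (if t > 0 then exp (- inverse t) else 0)"

text \<open>
  The \<open>n\<close>-th derivative of \<open>exp (- 1 / t)\<close> for \<open>t > 0\<close> is the \<open>n\<close>-th of these polynomials in \<open>1 / t\<close>, times \<open>exp (- 1 / t)\<close>.
\<close>
primrec flat_poly :: "nat \<Rightarrow> real poly" where
  "flat_poly 0 = 1"
| "flat_poly (Suc n) = monom 1 2 * (flat_poly n - pderiv (flat_poly n))"

definition flat_exp_deriv :: "nat \<Rightarrow> real \<Rightarrow> real" where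
  "flat_exp_deriv n t = (if t > 0 then poly (flat_poly n) (inverse t) * exp (- inverse t) else 0)"

lemma flat_exp_deriv_0: "flat_exp_deriv 0 = flat_exp"
  by (auto simp: flat_exp_def flat_exp_deriv_def)

lemma poly_mult_exp_tendsto_0: "((\<lambda>s. poly q s * exp (- s)) \<longlongrightarrow> (0::real)) at_top"
proof -
  have "((\<lambda>s. \<Sum>i\<le>degree q. coeff q i * (s ^ i / exp s)) \<longlongrightarrow> (\<Sum>i\<le>degree q. coeff q i * 0)) at_top"
    by (intro tendsto_intros tendsto_power_div_exp_0)
  then show ?thesis
    by (simp add: poly_altdef sum_distrib_right exp_minus divide_inverse mult.assoc)
qed

text \<open>
  Away from \<open>0\<close> this is the recursion of the polynomials. At \<open>0\<close> the difference quotient from the right is a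
  polynomial in \<open>s = 1 / t\<close> times \<open>exp (- s)\<close>, and the exponential wins.
\<close>
lemma flat_exp_deriv_has_derivative:
  "(flat_exp_deriv n has_field_derivative flat_exp_deriv (Suc n) t) (at t)"
proof -
  consider "t > 0" | "t < 0" | "t = 0" by linarith
  then show ?thesis
  proof cases
    case 1
    have "((\<lambda>t. poly (flat_poly n) (inverse t) * exp (- inverse t)) has_field_derivative
        flat_exp_deriv (Suc n) t) (at t)"
      using 1 by (auto intro!: derivative_eq_intros simp: flat_exp_deriv_def poly_monom field_simps power2_eq_square)
    then show ?thesis
      by (rule has_field_derivative_transform_within_open[where S = "{0<..}"])
        (use 1 in \<open>auto simp: flat_exp_deriv_def\<close>)
  next
    case 2
    have "((\<lambda>t. 0) has_field_derivative flat_exp_deriv (Suc n) t) (at t)"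
      using 2 by (auto simp: flat_exp_deriv_def)
    then show ?thesis
      by (rule has_field_derivative_transform_within_open[where S = "{..<0}"])
        (use 2 in \<open>auto simp: flat_exp_deriv_def\<close>)
  next
    case 3
    let ?q = "[:0, 1:] * flat_poly n"
    have "((\<lambda>t. poly ?q (inverse t) * exp (- inverse t)) \<longlongrightarrow> 0) (at_right 0)"
      using filterlim_compose[OF poly_mult_exp_tendsto_0 filterlim_inverse_at_top_right] .
    then have r: "((\<lambda>t. flat_exp_deriv n t / t) \<longlongrightarrow> 0) (at_right 0)"
      by (rule Lim_transform_eventually)
        (auto simp: eventually_at_filter flat_exp_deriv_def divide_inverse mult_ac)
    have l: "((\<lambda>t. flat_exp_deriv n t / t) \<longlongrightarrow> 0) (at_left 0)"
      by (rule Lim_transform_eventually[OF tendsto_const])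
        (auto simp: eventually_at_filter flat_exp_deriv_def)
    have "((\<lambda>t. flat_exp_deriv n t / t) \<longlongrightarrow> 0) (at 0)"
      using l r filterlim_at_split by blast
    then show ?thesis
      using 3 by (simp add: has_field_derivative_iff flat_exp_deriv_def)
  qed
qed

text \<open>
  The factor \<open>Suc n\<close> steepens the cutoff: at every interior point the arguments of \<open>flat_exp\<close> tend to infinity, where
  \<open>flat_exp\<close> tends to \<open>1\<close>, while the support stays the same.
\<close>
definition box_cutoff :: "'a::euclidean_space \<Rightarrow> 'a \<Rightarrow> nat \<Rightarrow> 'a \<Rightarrow> real" where
  "box_cutoff a b n x =
     (\<Prod>i\<in>Basis. flat_exp (real (Suc n) * (x \<bullet> i - a \<bullet> i)) * flat_exp (real (Suc n) * (b \<bullet> i - x \<bullet> i)))"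

lemma flat_exp_bounds: "0 \<le> flat_exp t" "flat_exp t \<le> 1"
  by (auto simp: flat_exp_def)

lemma box_cutoff_bounds: "0 \<le> box_cutoff a b n x" "box_cutoff a b n x \<le> 1"
  unfolding box_cutoff_def
  by (auto intro!: prod_nonneg prod_le_1 mult_nonneg_nonneg mult_le_one flat_exp_bounds)

lemma box_cutoff_nonzero_iff: "box_cutoff a b n x \<noteq> 0 \<longleftrightarrow> x \<in> box a b"
  unfolding box_cutoff_def mem_box by (auto simp: flat_exp_def zero_less_mult_iff split: if_splits)

lemma box_cutoff_tendsto: "(\<lambda>n. box_cutoff a b n x) \<longlonglongrightarrow> indicator (box a b) x"
proof (cases "x \<in> box a b")
  case True
  have *: "(\<lambda>n. flat_exp (real (Suc n) * t)) \<longlonglongrightarrow> 1" if "t > 0" for t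
  proof -
    have "(\<lambda>n. exp (- (inverse (real (Suc n)) * inverse t))) \<longlonglongrightarrow> exp (- (0 * inverse t))"
      by (intro tendsto_intros LIMSEQ_inverse_real_of_nat)
    then show ?thesis using that
      by (simp add: flat_exp_def zero_less_mult_iff del: of_nat_Suc)
  qed
  have "(\<lambda>n. box_cutoff a b n x) \<longlonglongrightarrow> (\<Prod>i\<in>(Basis::'a set). 1 * 1)"
    unfolding box_cutoff_def
    by (intro tendsto_prod tendsto_mult *) (use True in \<open>auto simp: mem_box\<close>)
  then show ?thesis using True by simp
next
  case False
  then show ?thesis using box_cutoff_nonzero_iff[of a b _ x] by auto
qed

lemma box_cutoff_test_function:
  assumes "cbox a b \<subseteq> U"
  shows "box_cutoff a b n \<in> test_functions U"
proof -
  have 1: "C_k k (box_cutoff a b n)" for k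
  proof -
    have "C_k k (\<lambda>x::'a. flat_exp (real (Suc n) * (x \<bullet> i - a \<bullet> i)))" for i
      using C_k_compose_coordinate[of flat_exp_deriv k 0, OF flat_exp_deriv_has_derivative, of "real (Suc n)" i "- real (Suc n) * (a \<bullet> i)"]
      by (simp add: flat_exp_deriv_0 right_diff_distrib del: of_nat_Suc)
    moreover have "C_k k (\<lambda>x::'a. flat_exp (real (Suc n) * (b \<bullet> i - x \<bullet> i)))" for i
      using C_k_compose_coordinate[of flat_exp_deriv k 0, OF flat_exp_deriv_has_derivative, of "- real (Suc n)" i "real (Suc n) * (b \<bullet> i)"]
      by (simp add: flat_exp_deriv_0 right_diff_distrib del: of_nat_Suc)
    ultimately show ?thesis
      unfolding box_cutoff_def[abs_def] by (intro C_k_prod C_k_mult)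
  qed
  have "{x. box_cutoff a b n x \<noteq> 0} = box a b"
    using box_cutoff_nonzero_iff by blast
  moreover have "closure (box a b) \<subseteq> cbox a b"
    by (simp add: box_subset_cbox closure_minimal closed_cbox)
  moreover have "compact (closure (box a b))"
    by (simp add: bounded_box compact_closure)
  ultimately show ?thesis using 1 assms by (auto simp: test_functions_def)
qed

lemma test_functions_diff:
  assumes "\<phi> \<in> test_functions U" "\<psi> \<in> test_functions U"
  shows "(\<lambda>x. \<phi> x - \<psi> x) \<in> test_functions U"
proof -
  have smooth: "\<forall>k. C_k k (\<lambda>x. \<phi> x - \<psi> x)"
    using assms C_k_diff unfolding test_functions_def by blast
  have "closure {x. \<phi> x - \<psi> x \<noteq> 0} \<subseteq> closure ({x. \<phi> x \<noteq> 0} \<union> {x. \<psi> x \<noteq> 0})"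
    by (rule closure_mono) auto
  then have sub: "closure {x. \<phi> x - \<psi> x \<noteq> 0} \<subseteq> closure {x. \<phi> x \<noteq> 0} \<union> closure {x. \<psi> x \<noteq> 0}"
    by simp
  have "compact (closure {x. \<phi> x \<noteq> 0} \<union> closure {x. \<psi> x \<noteq> 0})"
    using assms by (auto simp: test_functions_def intro: compact_Un)
  with sub have "compact (closure {x. \<phi> x - \<psi> x \<noteq> 0})"
    using bounded_subset[OF compact_imp_bounded] compact_eq_bounded_closed closed_closure by blast
  then show ?thesis
    using assms sub smooth unfolding test_functions_def by blast
qed

section \<open>The fundamental lemma of the calculus of variations\<close>

lemma AE_lebesgue_on_iff:
  "S \<in> sets lebesgue \<Longrightarrow> (AE x in lebesgue_on S. P x) \<longleftrightarrow> (AE x in lebesgue. x \<in> S \<longrightarrow> P x)"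
  by (simp add: AE_restrict_space_iff)

lemma AE_notin_negligible: "negligible N \<Longrightarrow> AE x in lebesgue. x \<notin> N"
  by (simp add: AE_not_in negligible_iff_null_sets)

text \<open>
  Completeness of Lebesgue measure makes a function measurable once it agrees almost everywhere with a measurable
  one. Chosen weak gradients come without any other measurability information.
\<close>
lemma borel_measurable_lebesgue_on_AE_cong:
  fixes f g :: "'a::euclidean_space \<Rightarrow> 'b::euclidean_space"
  assumes f: "f \<in> borel_measurable (lebesgue_on S)" and S: "S \<in> sets lebesgue"
    and eq: "AE x in lebesgue_on S. f x = g x"
  shows "g \<in> borel_measurable (lebesgue_on S)"
proof -
  obtain N where N: "N \<in> null_sets (lebesgue_on S)" "{x \<in> S. f x \<noteq> g x} \<subseteq> N"
    using eq unfolding eventually_ae_filter by auto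
  have "f \<in> borel_measurable (lebesgue_on (S - N))"
    using f borel_measurable_diff_null[OF N(1) S] by blast
  then have "g \<in> borel_measurable (lebesgue_on (S - N))"
    by (rule measurable_lebesgue_cong[THEN iffD1, rotated]) (use N in auto)
  then show ?thesis
    using borel_measurable_diff_null[OF N(1) S] by blast
qed

lemma integrable_continuous_compact:
  fixes f :: "'a::euclidean_space \<Rightarrow> 'b::euclidean_space"
  assumes "compact K" "continuous_on K f"
  shows "integrable (lebesgue_on K) f"
proof -
  have "integrable lborel (\<lambda>x. indicator K x *\<^sub>R f x)"
    using borel_integrable_compact[OF assms] .
  then have "integrable lebesgue (\<lambda>x. indicator K x *\<^sub>R f x)"
    by (meson borel_measurable_integrable integrable_completion)
  then show ?thesis
    using assms by (simp add: integrable_restrict_space borel_compact)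
qed

lemma integrable_lebesgue_on_supset:
  fixes f :: "'a::euclidean_space \<Rightarrow> 'b::euclidean_space"
  assumes "integrable (lebesgue_on K) f" "K \<subseteq> U" "K \<in> sets lebesgue" "U \<in> sets lebesgue"
    "\<And>x. x \<in> U - K \<Longrightarrow> f x = 0"
  shows "integrable (lebesgue_on U) f" "integral\<^sup>L (lebesgue_on U) f = integral\<^sup>L (lebesgue_on K) f"
proof -
  have eq: "(\<lambda>x. if x \<in> U then f x else 0) = (\<lambda>x. if x \<in> K then f x else 0)"
    using assms(2,5) by (intro ext) auto
  show "integrable (lebesgue_on U) f"
    using Lebesgue_Measure.integrable_restrict_UNIV[OF assms(3), of f] Lebesgue_Measure.integrable_restrict_UNIV[OF assms(4), of f] eq assms(1)
    by simp
  show "integral\<^sup>L (lebesgue_on U) f = integral\<^sup>L (lebesgue_on K) f"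
    using Lebesgue_Measure.integral_restrict_UNIV[OF assms(3), of f] Lebesgue_Measure.integral_restrict_UNIV[OF assms(4), of f] eq
    by simp
qed

lemma integrable_mult_continuous_compact:
  fixes g \<phi> :: "'a::euclidean_space \<Rightarrow> real"
  assumes g: "integrable (lebesgue_on K) g" and K: "compact K" and \<phi>: "continuous_on K \<phi>"
  shows "integrable (lebesgue_on K) (\<lambda>x. g x * \<phi> x)"
proof -
  have Ks: "K \<in> sets lebesgue" using K by (simp add: borel_compact)
  obtain B where B: "\<And>x. x \<in> K \<Longrightarrow> \<bar>\<phi> x\<bar> \<le> B"
    using compact_imp_bounded[OF compact_continuous_image[OF \<phi> K]] unfolding bounded_iff by auto
  have m: "\<phi> \<in> borel_measurable (lebesgue_on K)"
    using continuous_imp_measurable_on_sets_lebesgue[OF \<phi> Ks] .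
  show ?thesis
  proof (rule Bochner_Integration.integrable_bound)
    show "integrable (lebesgue_on K) (\<lambda>x. B * g x)" using g by simp
    show "(\<lambda>x. g x * \<phi> x) \<in> borel_measurable (lebesgue_on K)"
      using g m by measurable
    show "AE x in lebesgue_on K. norm (g x * \<phi> x) \<le> norm (B * g x)"
    proof (rule AE_I2)
      fix x assume "x \<in> space (lebesgue_on K)"
      then have "\<bar>\<phi> x\<bar> \<le> \<bar>B\<bar>" using B by force
      then show "norm (g x * \<phi> x) \<le> norm (B * g x)"
        by (simp add: abs_mult mult.commute mult_right_mono)
    qed
  qed
qed

text \<open>
  Local integrability controls integrals over compact subsets only; a factor with compact support moves the integral over
  the open set to such a subset.
\<close>
lemma locally_integrable_mult_compact_support:
  fixes g \<phi> :: "'a::euclidean_space \<Rightarrow> real"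
  assumes g: "locally_integrable U g" and K: "compact K" "K \<subseteq> U" and \<phi>: "continuous_on K \<phi>"
    "\<And>x. x \<in> U - K \<Longrightarrow> \<phi> x = 0" and U: "open U"
  shows "integrable (lebesgue_on U) (\<lambda>x. g x * \<phi> x)"
    "(LINT x|lebesgue_on U. g x * \<phi> x) = (LINT x|lebesgue_on K. g x * \<phi> x)"
proof -
  have "integrable (lebesgue_on K) (\<lambda>x. g x * \<phi> x)"
    using g K \<phi> by (intro integrable_mult_continuous_compact) (auto simp: locally_integrable_def)
  moreover have "K \<in> sets lebesgue" "U \<in> sets lebesgue"
    using K U by (auto simp: borel_compact)
  ultimately show "integrable (lebesgue_on U) (\<lambda>x. g x * \<phi> x)"
    "(LINT x|lebesgue_on U. g x * \<phi> x) = (LINT x|lebesgue_on K. g x * \<phi> x)"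
    using integrable_lebesgue_on_supset[of K "\<lambda>x. g x * \<phi> x" U] K \<phi> by auto
qed

text \<open>
  The cutoffs of the box are test functions and converge boundedly to its indicator.
\<close>
lemma integral_box_eq_0:
  fixes g :: "'a::euclidean_space \<Rightarrow> real"
  assumes U: "open U" and g: "locally_integrable U g"
    and 0: "\<And>\<phi>. \<phi> \<in> test_functions U \<Longrightarrow> (LINT x|lebesgue_on U. g x * \<phi> x) = 0"
    and ab: "cbox a b \<subseteq> U"
  shows "(LINT x|lebesgue_on (cbox a b). g x * indicator (box a b) x) = 0"
proof -
  let ?M = "lebesgue_on (cbox a b)"
  have gi: "integrable ?M g" using g ab by (auto simp: locally_integrable_def)
  have cont: "continuous_on UNIV (box_cutoff a b n)" for n
  proof -
    have "C_k 0 (box_cutoff a b n)"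
      using box_cutoff_test_function[OF ab, of n] unfolding test_functions_def by blast
    then show ?thesis by simp
  qed
  have m: "box_cutoff a b n \<in> borel_measurable ?M" for n
    by (rule continuous_imp_measurable_on_sets_lebesgue[OF continuous_on_subset[OF cont]]) auto
  have bx: "box a b \<subseteq> cbox a b" by (rule box_subset_cbox)
  have "(LINT x|?M. g x * box_cutoff a b n x) = 0" for n
  proof -
    have "(LINT x|lebesgue_on U. g x * box_cutoff a b n x) = (LINT x|?M. g x * box_cutoff a b n x)"
      using box_cutoff_nonzero_iff[of a b n] bx
      by (intro locally_integrable_mult_compact_support(2)[OF g _ ab _ _ U]
           continuous_on_subset[OF cont]) auto
    then show ?thesis using 0[OF box_cutoff_test_function[OF ab]] by simp
  qed
  moreover have "(\<lambda>n. LINT x|?M. g x * box_cutoff a b n x) \<longlonglongrightarrow> (LINT x|?M. g x * indicator (box a b) x)"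
  proof (rule integral_dominated_convergence[where w = "\<lambda>x. \<bar>g x\<bar>"])
    have "box a b \<in> sets ?M"
      using bx by (auto simp: sets_restrict_space_iff)
    then show "(\<lambda>x. g x * indicator (box a b) x) \<in> borel_measurable ?M"
      using gi by auto
    show "(\<lambda>x. g x * box_cutoff a b n x) \<in> borel_measurable ?M" for n
      using gi m by auto
    show "integrable ?M (\<lambda>x. \<bar>g x\<bar>)" using gi by auto
    show "AE x in ?M. (\<lambda>n. g x * box_cutoff a b n x) \<longlonglongrightarrow> g x * indicator (box a b) x"
      by (intro AE_I2 tendsto_intros box_cutoff_tendsto)
    show "AE x in ?M. norm (g x * box_cutoff a b n x) \<le> \<bar>g x\<bar>" for n
      by (intro AE_I2) (auto simp: abs_mult box_cutoff_bounds intro: mult_left_le)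
  qed
  ultimately show ?thesis using LIMSEQ_unique by (simp add: LIMSEQ_const_iff)
qed

text \<open>
  Since the total integral is zero, the sets over which the integral vanishes form a Dynkin system. It contains the boxes, which are closed under
  intersection and generate the Borel sets, so it contains every Borel set.
\<close>
lemma AE_eq_0_if_integral_boxes_eq_0:
  fixes G :: "'a::euclidean_space \<Rightarrow> real"
  assumes G: "integrable lebesgue G"
    and boxes: "\<And>c d. (LINT x|lebesgue. G x * indicator (box c d) x) = 0"
    and all: "integral\<^sup>L lebesgue G = 0"
  shows "AE x in lebesgue. G x = 0"
proof -
  obtain G' where G'[measurable]: "G' \<in> borel_measurable lborel" and "AE x in lborel. G x = G' x"
    using completion_ex_borel_measurable_real[of G lborel] G by blast
  then have ae: "AE x in lebesgue. G x = G' x"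
    using AE_completion by blast
  have G'l: "G' \<in> borel_measurable lebesgue"
    using G' measurable_completion by blast
  have "integrable lebesgue G'"
    by (rule integrable_cong_AE_imp[OF G G'l ae])
  then have int: "integrable lborel G'"
    using G' integrable_completion by blast
  have eq: "(LINT x|lborel. G' x * indicator A x) = (LINT x|lebesgue. G x * indicator A x)"
    if "A \<in> sets borel" for A
  proof -
    have "(LINT x|lborel. G' x * indicator A x) = (LINT x|lebesgue. G' x * indicator A x)"
      using that by (intro integral_completion[symmetric]) auto
    also have "\<dots> = (LINT x|lebesgue. G x * indicator A x)"
    proof (intro integral_cong_AE borel_measurable_times)
      show "AE x in lebesgue. G' x * indicat_real A x = G x * indicat_real A x"
        using ae by eventually_elim simp
    qed (use that G G'l in \<open>auto intro!: borel_measurable_indicator\<close>)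
    finally show ?thesis .
  qed
  have all': "integral\<^sup>L lborel G' = 0" using eq[of UNIV] all by simp
  have zero: "(LINT x:A|lborel. G' x) = 0" if A: "A \<in> sets borel" for A
  proof -
    have A': "A \<in> sigma_sets UNIV (range (\<lambda>(a, b). box a b :: 'a set))"
      using A by (metis borel_eq_box sets_measure_of top_greatest Pow_UNIV)
    have borel: "B \<in> sets borel" if "B \<in> sigma_sets UNIV (range (\<lambda>(a, b). box a b :: 'a set))" for B
      using that by (metis borel_eq_box sets_measure_of top_greatest Pow_UNIV)
    have si: "set_integrable lborel B G'" if "B \<in> sets borel" for B
      using int that unfolding set_integrable_def by (intro integrable_mult_indicator) auto
    have "Int_stable (range (\<lambda>(a, b). box a b :: 'a set))"
      by (auto simp: Int_stable_def box_Int_box)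
    moreover have "range (\<lambda>(a, b). box a b :: 'a set) \<subseteq> Pow UNIV" by simp
    ultimately show ?thesis using A'
    proof (induction rule: sigma_sets_induct_disjoint)
      case (basic B)
      then show ?case using eq[of B] boxes
        by (auto simp: set_lebesgue_integral_def mult.commute)
    next
      case (compl B)
      then have "(LINT x:UNIV|lborel. G' x) = (LINT x:UNIV - B|lborel. G' x) + (LINT x:B|lborel. G' x)"
        using borel[of B] si by (subst set_integral_Un[symmetric]) (auto simp: Un_commute)
      then show ?case using compl all' by (simp add: set_lebesgue_integral_def)
    next
      case (union A)
      have Ai: "A i \<in> sets borel" for i using borel union(2) by blast
      have "(LINT x:(\<Union>i. A i)|lborel. G' x) = (\<Sum>i. (LINT x:(A i)|lborel. G' x))"
        using union(1) Ai
        by (intro lebesgue_integral_countable_add si) (auto simp: disjoint_family_on_def)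
      then show ?case using union by simp
    qed (auto simp: set_lebesgue_integral_def)
  qed
  have "AE x in lborel. G' x = 0"
    by (rule density_unique_real[OF int, of "\<lambda>x. 0"]) (use zero in \<open>auto simp: set_lebesgue_integral_def\<close>)
  then have "AE x in lebesgue. G' x = 0" using AE_completion by blast
  with ae show ?thesis by eventually_elim auto
qed

text \<open>
  The fundamental lemma of the calculus of variations. On a closed box inside the open set the integrals of \<open>g\<close> over all
  smaller boxes vanish, so \<open>g\<close> is zero there; countably many such boxes exhaust the open set.
\<close>
lemma AE_eq_0_if_test_integrals_eq_0:
  fixes g :: "'a::euclidean_space \<Rightarrow> real"
  assumes U: "open U" and g: "locally_integrable U g"
    and 0: "\<And>\<phi>. \<phi> \<in> test_functions U \<Longrightarrow> (LINT x|lebesgue_on U. g x * \<phi> x) = 0"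
  shows "AE x in lebesgue_on U. g x = 0"
proof -
  have box: "AE x in lebesgue. x \<in> cbox a b \<longrightarrow> g x = 0" if ab: "cbox a b \<subseteq> U" for a b
  proof -
    \<comment> \<open>The open box is used because its intersection with another open box is again an open box or empty.\<close>
    let ?G = "\<lambda>x. if x \<in> cbox a b then g x * indicator (box a b) x else 0"
    have G: "?G x = (if x \<in> cbox a' b' then g x * indicator (box a b) x else 0)"
      if "cbox a b \<subseteq> cbox a' b'" for x a' b' using that box_subset_cbox[of a b] by (auto simp: indicator_def)
    have gi: "integrable (lebesgue_on (cbox a b)) g" using g ab by (auto simp: locally_integrable_def)
    have "integrable (lebesgue_on (cbox a b)) (\<lambda>x. g x * indicator (box a b) x)"
      using gi box_subset_cbox[of a b]
      by (intro integrable_real_mult_indicator) (auto simp: sets_restrict_space_iff)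
    then have Gi: "integrable lebesgue ?G" by (subst Lebesgue_Measure.integrable_restrict_UNIV) auto
    have bxs: "(LINT x|lebesgue. ?G x * indicator (box c d) x) = 0" for c d
    proof -
      obtain a' b' where ab': "box a b \<inter> box c d = box a' b'" using box_Int_box by blast
      show ?thesis
      proof (cases "box a' b' = {}")
        case True
        then have "?G x * indicator (box c d) x = 0" for x using ab' by (auto simp: indicator_def)
        then have "(\<lambda>x. ?G x * indicator (box c d) x) = (\<lambda>x. 0)" by blast
        then show ?thesis by simp
      next
        case False
        then have "cbox a' b' = closure (box a' b')" by simp
        also have "\<dots> \<subseteq> cbox a b"
          using ab' by (intro closure_minimal closed_cbox) (use box_subset_cbox[of a b] in blast)
        finally have sub: "cbox a' b' \<subseteq> U" using ab by blast
        have "(\<lambda>x. ?G x * indicator (box c d) x) = (\<lambda>x. if x \<in> cbox a' b' then g x * indicator (box a' b') x else 0)"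
          using ab'[symmetric] box_subset_cbox[of a' b'] box_subset_cbox[of a b]
          by (auto simp: fun_eq_iff indicator_def)
        then show ?thesis
          using integral_box_eq_0[OF U g 0 sub] by (simp add: Lebesgue_Measure.integral_restrict_UNIV)
      qed
    qed
    have "integral\<^sup>L lebesgue ?G = 0"
      using integral_box_eq_0[OF U g 0 ab] by (subst Lebesgue_Measure.integral_restrict_UNIV) auto
    then have "AE x in lebesgue. ?G x = 0"
      using AE_eq_0_if_integral_boxes_eq_0[OF Gi bxs] by blast
    moreover have "AE x in lebesgue. x \<notin> cbox a b - box a b"
      by (intro AE_notin_negligible negligible_frontier_interval)
    ultimately show ?thesis
      by eventually_elim (auto simp: indicator_def split: if_splits)
  qed
  obtain \<D> where D: "countable \<D>" "\<D> \<subseteq> Pow U" "\<And>X. X \<in> \<D> \<Longrightarrow> \<exists>a b. X = cbox a b" "\<Union>\<D> = U"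
    using open_countable_Union_open_cbox[OF U] by metis
  have "AE x in lebesgue. \<forall>X\<in>\<D>. x \<in> X \<longrightarrow> g x = 0"
    using D(1)
  proof (rule AE_ball_countable'[rotated])
    fix X assume X: "X \<in> \<D>"
    then obtain a b where "X = cbox a b" using D(3) by blast
    then show "AE x in lebesgue. x \<in> X \<longrightarrow> g x = 0" using box X D(2) by blast
  qed
  then have "AE x in lebesgue. x \<in> U \<longrightarrow> g x = 0"
    by eventually_elim (use D in blast)
  then show ?thesis using U by (subst AE_lebesgue_on_iff) auto
qed

section \<open>Weak gradients\<close>

text \<open>
  The definition of test functions offers partial derivatives one by one; integration by parts uses them as one
  continuous vector field with a common compact support.
\<close>
lemma test_function_gradient:
  assumes "\<phi> \<in> test_functions U"
  obtains G K where "\<And>x. (\<phi> has_derivative (\<lambda>h. G x \<bullet> h)) (at x)" "continuous_on UNIV G"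
    "continuous_on UNIV \<phi>" "\<And>i x. i \<in> Basis \<Longrightarrow> G x \<bullet> i = partial_deriv i \<phi> x"
    "compact K" "K \<subseteq> U" "\<And>x. x \<notin> K \<Longrightarrow> \<phi> x = 0" "\<And>x. x \<notin> K \<Longrightarrow> G x = 0"
proof -
  define K where "K = closure {x. \<phi> x \<noteq> 0}"
  define G where "G x = (\<Sum>i\<in>Basis. partial_deriv i \<phi> x *\<^sub>R i)" for x
  have Ck: "C_k 0 \<phi>" "C_k (Suc 0) \<phi>" and K: "compact K" "K \<subseteq> U"
    using assms unfolding test_functions_def K_def by blast+
  have diff: "\<phi> differentiable (at x)" for x using Ck by simp
  have G: "G x \<bullet> i = partial_deriv i \<phi> x" if "i \<in> Basis" for i x
    using that by (simp add: G_def)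
  have der: "(\<phi> has_derivative (\<lambda>h. G x \<bullet> h)) (at x)" for x
  proof -
    have fd: "(\<phi> has_derivative frechet_derivative \<phi> (at x)) (at x)"
      using diff frechet_derivative_works by blast
    interpret linear "frechet_derivative \<phi> (at x)"
      using fd has_derivative_linear by blast
    have "frechet_derivative \<phi> (at x) h = G x \<bullet> h" for h
    proof -
      have "frechet_derivative \<phi> (at x) h = frechet_derivative \<phi> (at x) (\<Sum>i\<in>Basis. (h \<bullet> i) *\<^sub>R i)"
        by (simp add: euclidean_representation)
      also have "\<dots> = (\<Sum>i\<in>Basis. (h \<bullet> i) * partial_deriv i \<phi> x)"
        by (simp add: sum scale partial_deriv_def)
      also have "\<dots> = G x \<bullet> h"
        by (subst euclidean_inner) (simp add: G mult.commute)
      finally show ?thesis .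
    qed
    then have "frechet_derivative \<phi> (at x) = (\<lambda>h. G x \<bullet> h)" by (rule ext)
    then show ?thesis using fd by simp
  qed
  have z: "\<phi> x = 0" if "x \<notin> K" for x
    using that closure_subset[of "{x. \<phi> x \<noteq> 0}"] by (auto simp: K_def)
  have "G x = 0" if x: "x \<notin> K" for x
  proof -
    have "((\<lambda>x. 0::real) has_derivative (\<lambda>h. G x \<bullet> h)) (at x)"
      by (rule has_derivative_transform_within_open[OF der, of "- K"])
        (use x z compact_imp_closed[OF K(1)] in \<open>auto simp: open_Compl\<close>)
    \<comment> \<open>Off the support the zero function has the same derivative.\<close>
    then have "(\<lambda>h. G x \<bullet> h) = (\<lambda>h. 0)"
      using has_derivative_unique has_derivative_const by blast
    then show ?thesis using fun_cong[of "\<lambda>h. G x \<bullet> h" "\<lambda>h. 0" "G x"] inner_eq_zero_iff by blast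
  qed
  moreover have "continuous_on UNIV G"
    unfolding G_def[abs_def] using Ck by (auto intro!: continuous_intros)
  ultimately show thesis using that der G K z Ck by auto
qed

text \<open>
  Values outside the open set do not matter. This lets discrete functions, which are affine or polynomial on one element
  only, be replaced by globally smooth ones.
\<close>
lemma has_weak_gradient_cong:
  assumes v: "has_weak_gradient U v g" and eq: "\<And>x. x \<in> U \<Longrightarrow> v x = v' x"
  shows "has_weak_gradient U v' g"
proof -
  have "locally_integrable U v'"
    unfolding locally_integrable_def
  proof (intro allI impI)
    fix K assume K: "compact K \<and> K \<subseteq> U"
    then have "integrable (lebesgue_on K) v"
      using v by (simp add: has_weak_gradient_def locally_integrable_def)
    then show "integrable (lebesgue_on K) v'"
      by (rule Bochner_Integration.integrable_cong[THEN iffD1, rotated 2]) (use K eq in auto)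
  qed
  moreover have "(LINT x|lebesgue_on U. v' x * \<phi> x) = (LINT x|lebesgue_on U. v x * \<phi> x)" for \<phi>
    by (rule Bochner_Integration.integral_cong) (use eq in auto)
  ultimately show ?thesis using v by (simp add: has_weak_gradient_def)
qed

lemma locally_integrable_diff:
  "locally_integrable U f \<Longrightarrow> locally_integrable U g \<Longrightarrow> locally_integrable U (\<lambda>x. f x - g x)"
  by (simp add: locally_integrable_def)

lemma locally_integrable_inner:
  "locally_integrable U f \<Longrightarrow> locally_integrable U (\<lambda>x. f x \<bullet> i)"
  by (simp add: locally_integrable_def)

lemma integrable_mult_test_function:
  assumes "open U" "locally_integrable U g" "\<phi> \<in> test_functions U"
  shows "integrable (lebesgue_on U) (\<lambda>x. g x * \<phi> x)"
    "i \<in> Basis \<Longrightarrow> integrable (lebesgue_on U) (\<lambda>x. g x * partial_deriv i \<phi> x)"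
proof -
  obtain G K where G: "continuous_on UNIV G"
    "continuous_on UNIV \<phi>" "\<And>i x. i \<in> Basis \<Longrightarrow> G x \<bullet> i = partial_deriv i \<phi> x"
    "compact K" "K \<subseteq> U" "\<And>x. x \<notin> K \<Longrightarrow> \<phi> x = 0" "\<And>x. x \<notin> K \<Longrightarrow> G x = 0"
    using test_function_gradient[OF assms(3)] by metis
  show "integrable (lebesgue_on U) (\<lambda>x. g x * \<phi> x)"
    using G assms continuous_on_subset[of UNIV \<phi> K]
    by (intro locally_integrable_mult_compact_support(1)[of U g K]) auto
  assume i: "i \<in> Basis"
  have "integrable (lebesgue_on U) (\<lambda>x. g x * (G x \<bullet> i))"
    using G assms continuous_on_subset[of UNIV G K]
    by (intro locally_integrable_mult_compact_support(1)[of U g K]) (auto intro!: continuous_intros)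
  then show "integrable (lebesgue_on U) (\<lambda>x. g x * partial_deriv i \<phi> x)"
    using G i by simp
qed

lemma has_weak_gradient_diff:
  assumes U: "open U" and v: "has_weak_gradient U v g" and w: "has_weak_gradient U w g'"
  shows "has_weak_gradient U (\<lambda>x. v x - w x) (\<lambda>x. g x - g' x)"
  unfolding has_weak_gradient_def
proof (intro conjI ballI)
  have li: "locally_integrable U v" "locally_integrable U w" "locally_integrable U g" "locally_integrable U g'"
    using v w by (simp_all add: has_weak_gradient_def)
  then show "locally_integrable U (\<lambda>x. v x - w x)" "locally_integrable U (\<lambda>x. g x - g' x)"
    by (simp_all add: locally_integrable_diff)
  fix \<phi> and i :: 'a assume \<phi>: "\<phi> \<in> test_functions U" and i: "i \<in> Basis"
  have int: "integrable (lebesgue_on U) (\<lambda>x. (g x \<bullet> i) * \<phi> x)"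
    "integrable (lebesgue_on U) (\<lambda>x. (g' x \<bullet> i) * \<phi> x)"
    using integrable_mult_test_function(1)[OF U locally_integrable_inner \<phi>] li by blast+
  have "(LINT x|lebesgue_on U. v x * partial_deriv i \<phi> x) = - (LINT x|lebesgue_on U. (g x \<bullet> i) * \<phi> x)"
    "(LINT x|lebesgue_on U. w x * partial_deriv i \<phi> x) = - (LINT x|lebesgue_on U. (g' x \<bullet> i) * \<phi> x)"
    using v w \<phi> i by (simp_all add: has_weak_gradient_def)
  then show "(LINT x|lebesgue_on U. (v x - w x) * partial_deriv i \<phi> x)
      = - (LINT x|lebesgue_on U. ((g x - g' x) \<bullet> i) * \<phi> x)"
    using integrable_mult_test_function(2)[OF U _ \<phi> i] li int
    by (simp add: left_diff_distrib inner_diff_left)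
qed

lemma weak_gradient_unique:
  fixes g g' :: "'a::euclidean_space \<Rightarrow> 'a"
  assumes U: "open U" and g: "has_weak_gradient U v g" and g': "has_weak_gradient U v g'"
  shows "AE x in lebesgue_on U. g x = g' x"
proof -
  have "AE x in lebesgue_on U. \<forall>i\<in>Basis. (g x - g' x) \<bullet> i = 0"
  proof (rule AE_finite_allI)
    fix i :: 'a assume i: "i \<in> Basis"
    have li: "locally_integrable U (\<lambda>x. g x \<bullet> i)" "locally_integrable U (\<lambda>x. g' x \<bullet> i)"
      using g g' by (auto simp: has_weak_gradient_def intro: locally_integrable_inner)
    show "AE x in lebesgue_on U. (g x - g' x) \<bullet> i = 0"
      unfolding inner_diff_left
    proof (rule AE_eq_0_if_test_integrals_eq_0[OF U locally_integrable_diff[OF li]])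
      fix \<phi> assume \<phi>: "\<phi> \<in> test_functions U"
      have "(LINT x|lebesgue_on U. v x * partial_deriv i \<phi> x) = - (LINT x|lebesgue_on U. (g x \<bullet> i) * \<phi> x)"
        "(LINT x|lebesgue_on U. v x * partial_deriv i \<phi> x) = - (LINT x|lebesgue_on U. (g' x \<bullet> i) * \<phi> x)"
        using g g' \<phi> i by (simp_all add: has_weak_gradient_def)
      then show "(LINT x|lebesgue_on U. (g x \<bullet> i - g' x \<bullet> i) * \<phi> x) = 0"
        using integrable_mult_test_function(1)[OF U _ \<phi>] li by (simp add: left_diff_distrib)
    qed
  qed simp
  then show ?thesis
  proof eventually_elim
    case (elim x)
    then have "g x - g' x = 0" using euclidean_all_zero_iff by blast
    then show ?case by simp
  qed
qed

text \<open>
  Whatever representative the choice operator selects, it may be replaced by any known weak gradient in integrals.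
\<close>
lemma weak_grad_AE_eq:
  assumes "open U" "has_weak_gradient U v g"
  shows "AE x in lebesgue_on U. weak_grad U v x = g x"
  unfolding weak_grad_def
  by (rule weak_gradient_unique[OF assms(1) someI[of "has_weak_gradient U v"] assms(2)]) (rule assms(2))

lemma integral_lborel_translate:
  fixes f :: "'a::euclidean_space \<Rightarrow> real"
  assumes "f \<in> borel_measurable borel"
  shows "(LINT x|lborel. f (c + x)) = (LINT x|lborel. f x)"
proof -
  have "(LINT x|lborel. f x) = (LINT x|distr lborel borel ((+) c). f x)"
    by (simp add: lborel_distr_plus)
  also have "\<dots> = (LINT x|lborel. f (c + x))"
    using assms by (intro integral_distr) auto
  finally show ?thesis by simp
qed

lemma has_derivative_difference_quotients:
  fixes f :: "'a::real_normed_vector \<Rightarrow> real"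
  assumes "(f has_derivative D) (at x)"
  shows "(\<lambda>n. real (Suc n) * (f (inverse (real (Suc n)) *\<^sub>R e + x) - f x)) \<longlonglongrightarrow> D e"
proof -
  have lin: "D (t *\<^sub>R e) = t * D e" for t
    using has_derivative_linear[OF assms] by (simp add: linear_cmul)
  have 1: "((\<lambda>t::real. t *\<^sub>R e + x) has_derivative (\<lambda>t. t *\<^sub>R e)) (at 0)"
    by (auto intro!: derivative_eq_intros)
  have "((\<lambda>t. f (t *\<^sub>R e + x)) has_derivative (\<lambda>t. D (t *\<^sub>R e))) (at 0)"
    using has_derivative_compose[OF 1, of f D] assms by simp
  then have "((\<lambda>t. f (t *\<^sub>R e + x)) has_field_derivative D e) (at 0)"
    by (simp add: has_field_derivative_def lin mult.commute[of _ "D e"])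
  then have "((\<lambda>t. (f (t *\<^sub>R e + x) - f x) / t) \<longlongrightarrow> D e) (at 0)"
    by (simp add: has_field_derivative_iff)
  moreover have "filterlim (\<lambda>n. inverse (real (Suc n))) (at 0) sequentially"
    using LIMSEQ_inverse_real_of_nat by (intro filterlim_atI) auto
  ultimately have "(\<lambda>n. (f (inverse (real (Suc n)) *\<^sub>R e + x) - f x) / inverse (real (Suc n))) \<longlonglongrightarrow> D e"
    by (rule filterlim_compose)
  then show ?thesis by (simp add: divide_inverse mult.commute)
qed

text \<open>
  The difference quotients in direction \<open>e\<close> have integral zero, because Lebesgue measure is translation invariant. The
  Lipschitz bound and the bounded support dominate them, so their pointwise limit has integral zero as well.
  Differentiability almost everywhere suffices, which admits functions with kinks such as a bubble extended by zero.
\<close>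
lemma integral_directional_derivative_eq_0:
  fixes \<psi> :: "'a::euclidean_space \<Rightarrow> real"
  assumes lip: "L-lipschitz_on UNIV \<psi>" and supp: "\<And>x. x \<notin> K \<Longrightarrow> \<psi> x = 0" "bounded K"
    and m: "D \<in> borel_measurable lebesgue"
    and der: "AE x in lebesgue. \<exists>\<psi>'. (\<psi> has_derivative \<psi>') (at x) \<and> \<psi>' e = D x"
  shows "integral\<^sup>L lebesgue D = 0"
proof -
  define t where "t n = inverse (real (Suc n))" for n
  define s where "s n x = real (Suc n) * (\<psi> (t n *\<^sub>R e + x) - \<psi> x)" for n x
  have t: "t n > 0" "t n \<le> 1" "real (Suc n) * t n = 1" for n
    by (simp_all add: t_def inverse_le_1_iff del: of_nat_Suc)
  have L: "0 \<le> L" using lip by (rule lipschitz_on_nonneg)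
  obtain R where R: "\<And>x. x \<in> K \<Longrightarrow> norm x \<le> R" using supp(2) unfolding bounded_iff by blast
  have cont: "continuous_on UNIV \<psi>" using lip by (rule lipschitz_on_continuous_on)
  have meas: "\<psi> \<in> borel_measurable borel" using cont by (rule borel_measurable_continuous_onI)
  have "integrable lborel (\<lambda>x. indicator (cball 0 R) x *\<^sub>R \<psi> x)"
    using continuous_on_subset[OF cont] by (intro borel_integrable_compact) auto
  moreover have "(\<lambda>x. indicator (cball 0 R) x *\<^sub>R \<psi> x) = \<psi>"
    using R supp(1) by (auto simp: fun_eq_iff indicator_def)
  ultimately have int: "integrable lborel \<psi>" by simp
  have int_t: "integrable lborel (\<lambda>x. \<psi> (c + x))" for c
  proof -
    have "integrable (distr lborel borel ((+) c)) \<psi>" using int by (simp add: lborel_distr_plus)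
    then show ?thesis using meas by (simp add: integrable_distr_eq)
  qed
  have sm: "s n \<in> borel_measurable borel" for n
    using meas unfolding s_def[abs_def] by measurable
  have "integral\<^sup>L lborel (s n) = 0" for n
    unfolding s_def using int int_t integral_lborel_translate[OF meas] by simp
  then have s0: "integral\<^sup>L lebesgue (s n) = 0" for n
    using sm integral_completion[of "s n" lborel] by simp
  \<comment> \<open>Steps are at most \<open>norm e\<close> long, so outside the enlarged ball both values of \<open>\<psi>\<close> in a quotient are zero.\<close>
  have bound: "\<bar>s n x\<bar> \<le> L * norm e * indicator (cball 0 (R + norm e)) x" for n x
  proof (cases "x \<in> cball 0 (R + norm e)")
    case True
    have "\<bar>\<psi> (t n *\<^sub>R e + x) - \<psi> x\<bar> \<le> L * norm (t n *\<^sub>R e)"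
      using lipschitz_onD[OF lip, of "t n *\<^sub>R e + x" x] by (simp add: dist_norm)
    then have "real (Suc n) * \<bar>\<psi> (t n *\<^sub>R e + x) - \<psi> x\<bar> \<le> real (Suc n) * (L * (t n * norm e))"
      using t(1)[of n] by (intro mult_left_mono) auto
    also have "\<dots> = L * norm e * (real (Suc n) * t n)" by simp
    also have "\<dots> = L * norm e" unfolding t(3) by simp
    finally show ?thesis using True by (simp add: s_def abs_mult)
  next
    case False
    then have n: "norm x > R + norm e" by simp
    have "norm (t n *\<^sub>R e) \<le> norm e" using t[of n] by (simp add: mult_left_le_one_le)
    then have "norm (t n *\<^sub>R e + x) > R"
      using n norm_triangle_ineq4[of "t n *\<^sub>R e + x" "t n *\<^sub>R e"] by simp
    moreover have "norm x > R" using n norm_ge_zero[of e] by linarith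
    ultimately have "\<psi> (t n *\<^sub>R e + x) = 0" "\<psi> x = 0"
      using R supp(1) by (meson not_le)+
    then show ?thesis using L by (simp add: s_def)
  qed
  have "(\<lambda>n. integral\<^sup>L lebesgue (s n)) \<longlonglongrightarrow> integral\<^sup>L lebesgue D"
  proof (rule integral_dominated_convergence[where w = "\<lambda>x. L * norm e * indicator (cball 0 (R + norm e)) x"])
    show "s n \<in> borel_measurable lebesgue" for n using sm by (simp add: measurable_completion)
    have "integrable lborel (indicator (cball (0::'a) (R + norm e)) :: 'a \<Rightarrow> real)"
      using emeasure_compact_finite[of "cball (0::'a) (R + norm e)"] by simp
    then have "integrable lebesgue (indicator (cball (0::'a) (R + norm e)) :: 'a \<Rightarrow> real)"
      by (subst integrable_completion) auto
    then show "integrable lebesgue (\<lambda>x. L * norm e * indicator (cball (0::'a) (R + norm e)) x)"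
      by simp
    show "AE x in lebesgue. (\<lambda>n. s n x) \<longlonglongrightarrow> D x"
      using der
    proof eventually_elim
      case (elim x)
      then obtain \<psi>' where \<psi>': "(\<psi> has_derivative \<psi>') (at x)" "\<psi>' e = D x" by blast
      show ?case
        using has_derivative_difference_quotients[OF \<psi>'(1), of e] unfolding \<psi>'(2) s_def t_def .
    qed
  qed (use m bound in auto)
  then show ?thesis using s0 by (simp add: LIMSEQ_const_iff)
qed

text \<open>
  Integration by parts: the product of the function with a test function, which is zero off a compact set, is Lipschitz, and its
  partial derivatives have integral zero.
\<close>
lemma has_weak_gradient_classical:
  fixes v :: "'a::euclidean_space \<Rightarrow> real"
  assumes U: "open U" and der: "\<And>x. x \<in> U \<Longrightarrow> (v has_derivative (\<lambda>h. g x \<bullet> h)) (at x)"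
    and g: "continuous_on U g"
  shows "has_weak_gradient U v g"
proof -
  have v: "continuous_on U v"
    using der U by (meson has_derivative_continuous continuous_at_imp_continuous_on)
  have li: "locally_integrable U v" "locally_integrable U g"
    using v g by (auto simp: locally_integrable_def intro: integrable_continuous_compact continuous_on_subset)
  moreover have "(LINT x|lebesgue_on U. v x * partial_deriv i \<phi> x) = - (LINT x|lebesgue_on U. (g x \<bullet> i) * \<phi> x)"
    if \<phi>: "\<phi> \<in> test_functions U" and i: "i \<in> Basis" for \<phi> i
  proof -
    obtain G K where G: "\<And>x. (\<phi> has_derivative (\<lambda>h. G x \<bullet> h)) (at x)" "continuous_on UNIV G"
      "continuous_on UNIV \<phi>" "\<And>i x. i \<in> Basis \<Longrightarrow> G x \<bullet> i = partial_deriv i \<phi> x"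
      "compact K" "K \<subseteq> U" "\<And>x. x \<notin> K \<Longrightarrow> \<phi> x = 0" "\<And>x. x \<notin> K \<Longrightarrow> G x = 0"
      using test_function_gradient[OF \<phi>] by metis
    \<comment> \<open>The gradient of the product \<open>v * \<phi>\<close>, continued by zero off \<open>U\<close>.\<close>
    define H where "H x = (if x \<in> U then v x *\<^sub>R G x + \<phi> x *\<^sub>R g x else 0)" for x
    have Hder: "((\<lambda>x. v x * \<phi> x) has_derivative (\<lambda>h. H x \<bullet> h)) (at x)" for x
    proof (cases "x \<in> U")
      case True
      then show ?thesis
        using has_derivative_mult[OF der[OF True] G(1)[of x]]
        by (simp add: H_def inner_add_left mult.commute)
    next
      case False
      then have x: "x \<notin> K" using G(6) by blast
      have "((\<lambda>x. v x * \<phi> x) has_derivative (\<lambda>h. 0)) (at x)"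
        by (rule has_derivative_transform_within_open[of "\<lambda>x. 0" _ _ _ "- K"])
          (use x G(5,7) in \<open>auto simp: compact_imp_closed\<close>)
      then show ?thesis using False by (simp add: H_def)
    qed
    have Hcont: "continuous_on U H"
      unfolding H_def using v g continuous_on_subset[OF G(2), of U] continuous_on_subset[OF G(3), of U]
      by (auto cong: continuous_on_cong intro!: continuous_intros)
    have H0: "H x = 0" if "x \<notin> K" for x using G that by (simp add: H_def)
    obtain B where B: "\<And>x. norm (H x) \<le> B"
    proof -
      have "bounded (H ` K)"
        using compact_continuous_image[OF continuous_on_subset[OF Hcont G(6)] G(5)] compact_imp_bounded by blast
      then obtain B where "\<And>x. x \<in> K \<Longrightarrow> norm (H x) \<le> B" unfolding bounded_iff by auto
      then have "norm (H x) \<le> max B 0" for x using H0[of x] by (cases "x \<in> K") force+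
      then show thesis using that by blast
    qed
    have "B-lipschitz_on UNIV (\<lambda>x. v x * \<phi> x)"
    proof (rule lipschitz_onI)
      show "0 \<le> B" using B norm_ge_zero order_trans by blast
      have on: "onorm (\<lambda>h. H x \<bullet> h) \<le> B" for x
      proof (rule onorm_bound)
        show "0 \<le> B" by fact
        fix h show "norm (H x \<bullet> h) \<le> B * norm h"
          using Cauchy_Schwarz_ineq2[of "H x" h] mult_right_mono[OF B[of x], of "norm h"] by simp
      qed
      show "dist (v x * \<phi> x) (v y * \<phi> y) \<le> B * dist x y" for x y
        unfolding dist_norm
        by (rule differentiable_bound[OF convex_UNIV _ on]) (auto intro: Hder)
    qed
    moreover have "(\<lambda>x. H x \<bullet> i) \<in> borel_measurable lebesgue"
    proof -
      have "H \<in> borel_measurable (lebesgue_on U)"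
        using Hcont U by (intro continuous_imp_measurable_on_sets_lebesgue) auto
      then have "(\<lambda>x. if x \<in> U then H x else 0) \<in> borel_measurable lebesgue"
        using U by (intro borel_measurable_if_I) auto
      moreover have "(\<lambda>x. if x \<in> U then H x else 0) = H" by (auto simp: H_def)
      ultimately show ?thesis by simp
    qed
    moreover have "\<And>x. x \<notin> K \<Longrightarrow> v x * \<phi> x = 0" "bounded K"
      using G compact_imp_bounded by auto
    ultimately have "(LINT x|lebesgue. H x \<bullet> i) = 0"
      using Hder by (intro integral_directional_derivative_eq_0[where \<psi> = "\<lambda>x. v x * \<phi> x" and e = i]) auto
    moreover have "(\<lambda>x. H x \<bullet> i) = (\<lambda>x. if x \<in> U then v x * partial_deriv i \<phi> x + (g x \<bullet> i) * \<phi> x else 0)"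
      using i G(4) by (auto simp: H_def inner_add_left)
    ultimately have "(LINT x|lebesgue_on U. v x * partial_deriv i \<phi> x + (g x \<bullet> i) * \<phi> x) = 0"
      using U by (simp add: Lebesgue_Measure.integral_restrict_UNIV)
    moreover have "integrable (lebesgue_on U) (\<lambda>x. v x * partial_deriv i \<phi> x)"
      "integrable (lebesgue_on U) (\<lambda>x. (g x \<bullet> i) * \<phi> x)"
      using integrable_mult_test_function[OF U _ \<phi>] li locally_integrable_inner i by blast+
    ultimately show ?thesis by simp
  qed
  ultimately show ?thesis by (simp add: has_weak_gradient_def)
qed

section \<open>Square-integrable functions and Sobolev spaces\<close>

lemma L2_norm_power2: "(L2_norm S v)\<^sup>2 = (LINT x|lebesgue_on S. (norm (v x))\<^sup>2)"
  unfolding L2_norm_def by (simp add: integral_nonneg_AE)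

lemma L2_norm_nonneg [simp]: "0 \<le> L2_norm S v"
  unfolding L2_norm_def by (simp add: integral_nonneg_AE)

lemma L2_measurable: "v \<in> L2 S \<Longrightarrow> v \<in> borel_measurable (lebesgue_on S)"
  and L2_integrable: "v \<in> L2 S \<Longrightarrow> integrable (lebesgue_on S) (\<lambda>x. (norm (v x))\<^sup>2)"
  by (simp_all add: L2_def)

lemma L2_dominated:
  fixes v w :: "'a::euclidean_space \<Rightarrow> 'b::euclidean_space"
    and F :: "'a \<Rightarrow> real"
  assumes "v \<in> borel_measurable (lebesgue_on S)" "integrable (lebesgue_on S) F"
    "AE x in lebesgue_on S. (norm (v x))\<^sup>2 \<le> F x"
  shows "v \<in> L2 S"
proof -
  have "integrable (lebesgue_on S) (\<lambda>x. (norm (v x))\<^sup>2)"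
  proof (rule Bochner_Integration.integrable_bound[OF assms(2)])
    show "(\<lambda>x. (norm (v x))\<^sup>2) \<in> borel_measurable (lebesgue_on S)"
      using assms(1) by measurable
    show "AE x in lebesgue_on S. norm ((norm (v x))\<^sup>2) \<le> norm (F x)"
      using assms(3) by eventually_elim simp
  qed
  then show ?thesis using assms(1) by (simp add: L2_def)
qed

lemma L2_add:
  fixes v w :: "'a::euclidean_space \<Rightarrow> 'b::euclidean_space"
  assumes "v \<in> L2 S" "w \<in> L2 S"
  shows "(\<lambda>x. v x + w x) \<in> L2 S"
proof (rule L2_dominated)
  show "(\<lambda>x. v x + w x) \<in> borel_measurable (lebesgue_on S)"
    using assms by (auto dest!: L2_measurable)
  show "integrable (lebesgue_on S) (\<lambda>x. 2 * (norm (v x))\<^sup>2 + 2 * (norm (w x))\<^sup>2)"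
    using assms by (auto dest!: L2_integrable)
  have "(norm (a + b))\<^sup>2 \<le> 2 * (norm a)\<^sup>2 + 2 * (norm b)\<^sup>2" for a b :: 'b
  proof -
    have "(norm (a + b))\<^sup>2 \<le> (norm a + norm b)\<^sup>2" by (simp add: norm_triangle_ineq power_mono)
    also have "\<dots> \<le> 2 * (norm a)\<^sup>2 + 2 * (norm b)\<^sup>2"
      using sum_squares_bound[of "norm a" "norm b"] by (simp add: power2_sum)
    finally show ?thesis .
  qed
  then show "AE x in lebesgue_on S. (norm (v x + w x))\<^sup>2 \<le> 2 * (norm (v x))\<^sup>2 + 2 * (norm (w x))\<^sup>2"
    by simp
qed

lemma L2_scaleR:
  fixes v :: "'a::euclidean_space \<Rightarrow> 'b::euclidean_space"
  assumes "v \<in> L2 S"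
  shows "(\<lambda>x. c *\<^sub>R v x) \<in> L2 S"
  using assms by (auto simp: L2_def power_mult_distrib)

lemma L2_norm_scaleR:
  fixes v :: "'a::euclidean_space \<Rightarrow> 'b::euclidean_space"
  shows "L2_norm S (\<lambda>x. c *\<^sub>R v x) = \<bar>c\<bar> * L2_norm S v"
  by (simp add: L2_norm_def power_mult_distrib real_sqrt_mult)

lemma L2_diff:
  fixes v w :: "'a::euclidean_space \<Rightarrow> 'b::euclidean_space"
  assumes "v \<in> L2 S" "w \<in> L2 S"
  shows "(\<lambda>x. v x - w x) \<in> L2 S"
  using L2_add[OF assms(1) L2_scaleR[OF assms(2), of "-1"]] by simp

lemma L2_norm_cong_AE:
  fixes v w :: "'a::euclidean_space \<Rightarrow> 'b::euclidean_space"
  assumes v: "v \<in> borel_measurable (lebesgue_on S)" and S: "S \<in> sets lebesgue"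
    and eq: "AE x in lebesgue_on S. v x = w x"
  shows "L2_norm S w = L2_norm S v"
proof -
  have w: "w \<in> borel_measurable (lebesgue_on S)"
    by (rule borel_measurable_lebesgue_on_AE_cong[OF v S eq])
  have "AE x in lebesgue_on S. (norm (w x))\<^sup>2 = (norm (v x))\<^sup>2"
    using eq by eventually_elim simp
  then have "(LINT x|lebesgue_on S. (norm (w x))\<^sup>2) = (LINT x|lebesgue_on S. (norm (v x))\<^sup>2)"
    by (rule integral_cong_AE[rotated 2]) (use v w in measurable)
  then show ?thesis by (simp add: L2_norm_def)
qed

lemma L2_cong_AE:
  fixes v w :: "'a::euclidean_space \<Rightarrow> 'b::euclidean_space"
  assumes v: "v \<in> L2 S" and S: "S \<in> sets lebesgue" and eq: "AE x in lebesgue_on S. v x = w x"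
  shows "w \<in> L2 S"
proof (rule L2_dominated)
  show "w \<in> borel_measurable (lebesgue_on S)"
    by (rule borel_measurable_lebesgue_on_AE_cong[OF L2_measurable[OF v] S eq])
  show "AE x in lebesgue_on S. (norm (w x))\<^sup>2 \<le> (norm (v x))\<^sup>2"
    using eq by eventually_elim simp
qed (rule L2_integrable[OF v])

lemma L2_norm_mono:
  fixes v :: "'a::euclidean_space \<Rightarrow> 'b::euclidean_space" and w :: "'a \<Rightarrow> 'c::euclidean_space"
  assumes "w \<in> L2 S" "AE x in lebesgue_on S. norm (v x) \<le> norm (w x)"
  shows "L2_norm S v \<le> L2_norm S w"
  unfolding L2_norm_def
proof (intro real_sqrt_le_mono integral_mono_AE' L2_integrable[OF assms(1)])
  show "AE x in lebesgue_on S. (norm (v x))\<^sup>2 \<le> (norm (w x))\<^sup>2"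
    using assms(2) by eventually_elim (simp add: power_mono)
qed simp

text \<open>
  For positive \<open>F\<close> and \<open>G\<close> the pointwise inequality
  \<open>\<bar>v + w\<bar>\<^sup>2 \<le> (1 + G / F) \<bar>v\<bar>\<^sup>2 + (1 + F / G) \<bar>w\<bar>\<^sup>2\<close> can be integrated. With \<open>F\<close> and \<open>G\<close> slightly above the two norms the right-hand side
  is at most \<open>(F + G)\<^sup>2\<close>.
\<close>
lemma L2_norm_triangle:
  fixes v w :: "'a::euclidean_space \<Rightarrow> 'b::euclidean_space"
  assumes v: "v \<in> L2 S" and w: "w \<in> L2 S"
  shows "L2_norm S (\<lambda>x. v x + w x) \<le> L2_norm S v + L2_norm S w"
proof (rule field_le_epsilon)
  fix e :: real assume e: "e > 0"
  \<comment> \<open>The shift by \<open>e / 2\<close> keeps both weights positive when a norm is zero.\<close>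
  define F G where "F = L2_norm S v + e / 2" and "G = L2_norm S w + e / 2"
  have pos: "F > 0" "G > 0" using e by (auto simp: F_def G_def add_nonneg_pos)
  have young: "(norm (a + b))\<^sup>2 \<le> (F + G) / F * (norm a)\<^sup>2 + (F + G) / G * (norm b)\<^sup>2" for a b :: 'b
  proof -
    have "(norm (a + b))\<^sup>2 \<le> (norm a + norm b)\<^sup>2" by (simp add: norm_triangle_ineq power_mono)
    also have "\<dots> \<le> (F + G) / F * (norm a)\<^sup>2 + (F + G) / G * (norm b)\<^sup>2"
    proof -
      have "(F + G) / F * (norm a)\<^sup>2 + (F + G) / G * (norm b)\<^sup>2 - (norm a + norm b)\<^sup>2
          = (G * norm a - F * norm b)\<^sup>2 / (F * G)"
        using pos by (simp add: field_simps power2_eq_square)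
      then show ?thesis using pos by (smt (verit) divide_nonneg_pos mult_pos_pos zero_le_power2)
    qed
    finally show ?thesis .
  qed
  have "(L2_norm S (\<lambda>x. v x + w x))\<^sup>2
      \<le> (LINT x|lebesgue_on S. (F + G) / F * (norm (v x))\<^sup>2 + (F + G) / G * (norm (w x))\<^sup>2)"
    unfolding L2_norm_power2
    by (rule integral_mono) (use L2_integrable[OF L2_add[OF v w]] L2_integrable[OF v] L2_integrable[OF w] young in auto)
  also have "\<dots> = (F + G) / F * (L2_norm S v)\<^sup>2 + (F + G) / G * (L2_norm S w)\<^sup>2"
    using L2_integrable[OF v] L2_integrable[OF w] by (simp add: L2_norm_power2)
  also have "\<dots> \<le> (F + G) / F * F\<^sup>2 + (F + G) / G * G\<^sup>2"
    using pos e by (intro add_mono mult_left_mono power_mono) (auto simp: F_def G_def)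
  also have "\<dots> = (F + G)\<^sup>2"
    using pos by (simp add: field_simps power2_eq_square)
  finally have "L2_norm S (\<lambda>x. v x + w x) \<le> F + G"
    by (rule power2_le_imp_le) (use pos in simp)
  then show "L2_norm S (\<lambda>x. v x + w x) \<le> L2_norm S v + L2_norm S w + e"
    by (simp add: F_def G_def)
qed

lemma L2_norm_triangle_diff:
  fixes v w :: "'a::euclidean_space \<Rightarrow> 'b::euclidean_space"
  assumes v: "v \<in> L2 S" and w: "w \<in> L2 S"
  shows "L2_norm S (\<lambda>x. v x - w x) \<le> L2_norm S v + L2_norm S w"
  using L2_norm_triangle[OF v L2_scaleR[OF w, of "-1"]] L2_norm_scaleR[of S "-1" w] by simp

lemma L2_norm_reverse_triangle:
  fixes v w :: "'a::euclidean_space \<Rightarrow> 'b::euclidean_space"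
  assumes v: "v \<in> L2 S" and w: "w \<in> L2 S"
  shows "\<bar>L2_norm S v - L2_norm S w\<bar> \<le> L2_norm S (\<lambda>x. v x - w x)"
  using L2_norm_triangle[OF L2_diff[OF v w] w] L2_norm_triangle_diff[OF L2_diff[OF v w] v]
    L2_norm_scaleR[of S "-1" w]
  by simp

lemma L2_continuous_compact:
  fixes v :: "'a::euclidean_space \<Rightarrow> 'b::euclidean_space"
  assumes "compact K" "continuous_on K v"
  shows "v \<in> L2 K"
  using assms unfolding L2_def
  by (auto intro!: integrable_continuous_compact continuous_imp_measurable_on_sets_lebesgue
      continuous_intros simp: borel_compact)

text \<open>
  Seminorms on an element integrate over the closed simplex a gradient that is determined in the interior only. The
  boundary is a null set, so the arbitrary values there are harmless.
\<close>
lemma weak_grad_AE_eq_on: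
  assumes S: "S \<in> sets lebesgue" and bd: "negligible (S - interior S)"
    and g: "has_weak_gradient (interior S) v g"
  shows "AE x in lebesgue_on S. g x = weak_grad (interior S) v x"
proof -
  have "AE x in lebesgue. x \<in> interior S \<longrightarrow> weak_grad (interior S) v x = g x"
    using weak_grad_AE_eq[OF open_interior g] by (subst (asm) AE_lebesgue_on_iff) auto
  moreover have "AE x in lebesgue. x \<notin> S - interior S" by (rule AE_notin_negligible[OF bd])
  ultimately have "AE x in lebesgue. x \<in> S \<longrightarrow> g x = weak_grad (interior S) v x"
    by eventually_elim auto
  then show ?thesis using S by (simp add: AE_lebesgue_on_iff)
qed

lemma H1_seminorm_eq:
  assumes "S \<in> sets lebesgue" "negligible (S - interior S)" "has_weak_gradient (interior S) v g"
    "g \<in> borel_measurable (lebesgue_on S)"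
  shows "H1_seminorm S v = L2_norm S g"
  unfolding H1_seminorm_def
  by (rule L2_norm_cong_AE[OF assms(4,1) weak_grad_AE_eq_on[OF assms(1-3)]])

lemma H1_seminorm_nonneg [simp]: "0 \<le> H1_seminorm S v"
  by (simp add: H1_seminorm_def)

lemma H1_norm_nonneg [simp]: "0 \<le> H1_norm S v"
  by (simp add: H1_norm_def)

lemma H1_seminorm_le_norm: "H1_seminorm S v \<le> H1_norm S v"
  unfolding H1_norm_def by (rule real_le_rsqrt) simp

lemma L2_norm_le_H1_norm: "L2_norm S v \<le> H1_norm S v"
  unfolding H1_norm_def by (rule real_le_rsqrt) simp

lemma H1_diff:
  assumes U: "open U" and "v \<in> H1 U" "w \<in> H1 U"
  shows "(\<lambda>x. v x - w x) \<in> H1 U"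
proof -
  obtain g h where "g \<in> L2 U" "has_weak_gradient U v g" "h \<in> L2 U" "has_weak_gradient U w h"
    "v \<in> L2 U" "w \<in> L2 U"
    using assms(2,3) unfolding H1_def by blast
  then have "has_weak_gradient U (\<lambda>x. v x - w x) (\<lambda>x. g x - h x)" "(\<lambda>x. g x - h x) \<in> L2 U"
    "(\<lambda>x. v x - w x) \<in> L2 U"
    by (simp_all add: has_weak_gradient_diff[OF U] L2_diff)
  then show ?thesis unfolding H1_def by blast
qed

lemma H1_norm_triangle_diff:
  fixes v w :: "'a::euclidean_space \<Rightarrow> real"
  assumes U: "open U" and v: "v \<in> H1 U" and w: "w \<in> H1 U"
  shows "H1_norm U (\<lambda>x. v x - w x) \<le> H1_norm U v + H1_norm U w"
proof -
  obtain g h where g: "g \<in> L2 U" "has_weak_gradient U v g" and h: "h \<in> L2 U" "has_weak_gradient U w h"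
    and vw: "v \<in> L2 U" "w \<in> L2 U"
    using v w by (auto simp: H1_def)
  have semi: "H1_seminorm U z = L2_norm U k" if "k \<in> L2 U" "has_weak_gradient U z k" for z k
    using that U by (intro H1_seminorm_eq) (auto simp: interior_open intro: L2_measurable)
  have "H1_seminorm U (\<lambda>x. v x - w x) = L2_norm U (\<lambda>x. g x - h x)"
    using g h by (intro semi L2_diff has_weak_gradient_diff[OF U])
  also have "\<dots> \<le> H1_seminorm U v + H1_seminorm U w"
    using L2_norm_triangle_diff[OF g(1) h(1)] semi g h by simp
  finally have "sqrt ((L2_norm U (\<lambda>x. v x - w x))\<^sup>2 + (H1_seminorm U (\<lambda>x. v x - w x))\<^sup>2)
      \<le> sqrt ((L2_norm U v + L2_norm U w)\<^sup>2 + (H1_seminorm U v + H1_seminorm U w)\<^sup>2)"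
    using L2_norm_triangle_diff[OF vw] by (intro real_sqrt_le_mono add_mono power_mono) auto
  also have "\<dots> \<le> H1_norm U v + H1_norm U w"
    unfolding H1_norm_def by (rule real_sqrt_sum_squares_triangle_ineq)
  finally show ?thesis by (simp add: H1_norm_def)
qed

lemma test_function_in_H1:
  fixes U :: "'a::euclidean_space set"
  assumes U: "open U" and \<phi>: "\<phi> \<in> test_functions U"
  shows "\<phi> \<in> H1 U"
proof -
  obtain G K where G: "\<And>x. (\<phi> has_derivative (\<lambda>h. G x \<bullet> h)) (at x)" "continuous_on UNIV G"
    "continuous_on UNIV \<phi>" "compact K" "K \<subseteq> U" "\<And>x. x \<notin> K \<Longrightarrow> \<phi> x = 0" "\<And>x. x \<notin> K \<Longrightarrow> G x = 0"
    using test_function_gradient[OF \<phi>] by metis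
  have L2: "k \<in> L2 U" if k: "continuous_on UNIV k" "\<And>x. x \<notin> K \<Longrightarrow> k x = 0"
    for k :: "'a \<Rightarrow> 'b::euclidean_space"
  proof -
    have "integrable (lebesgue_on K) (\<lambda>x. (norm (k x))\<^sup>2)"
      by (intro integrable_continuous_compact[OF G(4)] continuous_intros continuous_on_subset[OF k(1)]) simp
    then have "integrable (lebesgue_on U) (\<lambda>x. (norm (k x))\<^sup>2)"
      by (rule integrable_lebesgue_on_supset(1)) (use k(2) G(4,5) U in \<open>auto simp: borel_compact\<close>)
    moreover have "k \<in> borel_measurable (lebesgue_on U)"
      using U by (intro continuous_imp_measurable_on_sets_lebesgue continuous_on_subset[OF k(1)]) auto
    ultimately show ?thesis by (simp add: L2_def)
  qed
  have "has_weak_gradient U \<phi> G"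
    by (rule has_weak_gradient_classical[OF U G(1) continuous_on_subset[OF G(2) subset_UNIV]])
  then show ?thesis using L2[of \<phi>] L2[of G] G by (auto simp: H1_def)
qed

text \<open>
  The differences of two approximating sequences of test functions approximate the difference.
\<close>
lemma H10_diff:
  fixes v w :: "'a::euclidean_space \<Rightarrow> real"
  assumes U: "open U" and v: "v \<in> H10 U" and w: "w \<in> H10 U"
  shows "(\<lambda>x. v x - w x) \<in> H10 U"
proof -
  obtain \<phi> \<psi> where \<phi>: "\<And>n::nat. \<phi> n \<in> test_functions U" "(\<lambda>n. H1_norm U (\<lambda>x. v x - \<phi> n x)) \<longlonglongrightarrow> 0"
    and \<psi>: "\<And>n::nat. \<psi> n \<in> test_functions U" "(\<lambda>n. H1_norm U (\<lambda>x. w x - \<psi> n x)) \<longlonglongrightarrow> 0"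
    and vw: "v \<in> H1 U" "w \<in> H1 U"
    using v w unfolding H10_def by blast
  have le: "H1_norm U (\<lambda>x. (v x - w x) - (\<phi> n x - \<psi> n x))
      \<le> H1_norm U (\<lambda>x. v x - \<phi> n x) + H1_norm U (\<lambda>x. w x - \<psi> n x)" for n
  proof -
    have eq: "(v x - w x) - (\<phi> n x - \<psi> n x) = (v x - \<phi> n x) - (w x - \<psi> n x)" for x by simp
    show ?thesis
      unfolding eq
      by (intro H1_norm_triangle_diff[OF U] H1_diff[OF U] vw test_function_in_H1[OF U] \<phi> \<psi>)
  qed
  have lim: "(\<lambda>n. H1_norm U (\<lambda>x. v x - \<phi> n x) + H1_norm U (\<lambda>x. w x - \<psi> n x)) \<longlonglongrightarrow> 0"
    using tendsto_add[OF \<phi>(2) \<psi>(2)] by simp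
  have "(\<lambda>n. H1_norm U (\<lambda>x. (v x - w x) - (\<phi> n x - \<psi> n x))) \<longlonglongrightarrow> 0"
    by (rule tendsto_sandwich[OF _ _ tendsto_const lim])
      (intro always_eventually allI H1_norm_nonneg le)+
  moreover have "\<forall>n. (\<lambda>x. \<phi> n x - \<psi> n x) \<in> test_functions U"
    by (intro allI test_functions_diff \<phi> \<psi>)
  ultimately have "\<exists>\<zeta>. (\<forall>n. \<zeta> n \<in> test_functions U) \<and> (\<lambda>n. H1_norm U (\<lambda>x. (v x - w x) - \<zeta> n x)) \<longlonglongrightarrow> 0"
    by (intro exI[of _ "\<lambda>n x. \<phi> n x - \<psi> n x"] conjI)
  then show ?thesis
    using H1_diff[OF U vw] unfolding H10_def mem_Collect_eq by (intro conjI)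
qed

section \<open>Simplices, bubbles and the bubble projection\<close>

lemma simplex_vertices:
  fixes T :: "'a::euclidean_space set"
  assumes "int DIM('a) simplex T"
  shows "\<not> affine_dependent (vertices T)" "finite (vertices T)" "card (vertices T) = Suc DIM('a)"
    "T = convex hull (vertices T)"
proof -
  obtain C where C: "finite C" "\<not> affine_dependent C" "int (card C) = int DIM('a) + 1" "T = convex hull C"
    using assms unfolding simplex by blast
  have "vertices T = C"
    using extreme_point_of_convex_hull_affine_independent[OF C(2)] C(4) by (auto simp: vertices_def)
  then show "\<not> affine_dependent (vertices T)" "finite (vertices T)" "card (vertices T) = Suc DIM('a)"
    "T = convex hull (vertices T)"
    using C by auto
qed

lemma simplex_compact_convex:
  fixes T :: "'a::euclidean_space set"
  assumes "int DIM('a) simplex T"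
  shows "compact T" "convex T"
  using simplex_vertices(2,4)[OF assms] by (metis compact_convex_hull finite_imp_compact, metis convex_convex_hull)

context
  fixes T :: "'a::euclidean_space set"
  assumes T: "int DIM('a) simplex T"
begin

text \<open>
  The difference of two sets of coordinates would be an affine dependence of the vertices.
\<close>
lemma barycentric_coordinates_unique:
  assumes "(\<Sum>w\<in>vertices T. l w) = 1" "(\<Sum>w\<in>vertices T. l w *\<^sub>R w) = x"
    "(\<Sum>w\<in>vertices T. l' w) = 1" "(\<Sum>w\<in>vertices T. l' w *\<^sub>R w) = x" "a \<in> vertices T"
  shows "l a = l' a"
proof (rule ccontr)
  assume "l a \<noteq> l' a"
  then have "\<exists>U. sum U (vertices T) = 0 \<and> (\<exists>v\<in>vertices T. U v \<noteq> 0) \<and> (\<Sum>v\<in>vertices T. U v *\<^sub>R v) = 0"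
    using assms by (intro exI[of _ "\<lambda>v. l v - l' v"])
      (auto simp: sum_subtractf scaleR_diff_left)
  then show False
    using simplex_vertices(1,2)[OF T] affine_dependent_explicit_finite by blast
qed

lemma affine_hull_vertices: "affine hull (vertices T) = UNIV"
  using simplex_vertices[OF T] by (intro affine_independent_span_eq) auto

lemma barycentric_works:
  "(\<Sum>w\<in>vertices T. barycentric T w x) = 1"
  "(\<Sum>w\<in>vertices T. barycentric T w x *\<^sub>R w) = x"
proof -
  let ?P = "\<lambda>l. (\<forall>w. w \<notin> vertices T \<longrightarrow> l w = 0) \<and> (\<Sum>w\<in>vertices T. l w) = 1 \<and>
             (\<Sum>w\<in>vertices T. l w *\<^sub>R w) = x"
  have "x \<in> affine hull (vertices T)" using affine_hull_vertices by simp
  then obtain l where l: "sum l (vertices T) = 1" "(\<Sum>w\<in>vertices T. l w *\<^sub>R w) = x"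
    unfolding affine_hull_finite[OF simplex_vertices(2)[OF T]] by auto
  have "?P (\<lambda>w. if w \<in> vertices T then l w else 0)"
    using l by (simp cong: sum.cong if_cong)
  moreover have "m = (\<lambda>w. if w \<in> vertices T then l w else 0)" if "?P m" for m
    using that l barycentric_coordinates_unique[of m x l] by (auto simp: fun_eq_iff)
  ultimately have "?P (THE l. ?P l)" by (rule theI)
  then show "(\<Sum>w\<in>vertices T. barycentric T w x) = 1"
    "(\<Sum>w\<in>vertices T. barycentric T w x *\<^sub>R w) = x"
    unfolding barycentric_def by simp_all
qed

lemma barycentric_eqI:
  assumes "(\<Sum>w\<in>vertices T. l w) = 1" "(\<Sum>w\<in>vertices T. l w *\<^sub>R w) = x" "a \<in> vertices T"
  shows "barycentric T a x = l a"
  using barycentric_coordinates_unique[OF barycentric_works assms] .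

text \<open>
  Affine combinations of the coordinates of two points are coordinates of the same combination of the points, so uniqueness
  forces each coordinate to be an affine function on the whole space.
\<close>
lemma barycentric_affine:
  assumes a: "a \<in> vertices T"
  obtains p q where "\<And>x. barycentric T a x = p \<bullet> x + q"
proof -
  define f where "f x = barycentric T a x - barycentric T a 0" for x
  note w = barycentric_works
  have "linear f"
  proof (rule linearI)
    fix x y :: 'a and c :: real
    have "barycentric T a (x + y) = barycentric T a x + barycentric T a y - barycentric T a 0"
      by (rule barycentric_eqI[OF _ _ a, of "\<lambda>v. barycentric T v x + barycentric T v y - barycentric T v 0"])
        (simp_all add: sum.distrib sum_subtractf w scaleR_add_left scaleR_diff_left)
    then show "f (x + y) = f x + f y" by (simp add: f_def)
    have "barycentric T a (c *\<^sub>R x) = c * barycentric T a x + (1 - c) * barycentric T a 0"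
      by (rule barycentric_eqI[OF _ _ a, of "\<lambda>v. c * barycentric T v x + (1 - c) * barycentric T v 0"])
        (simp_all add: sum.distrib w scaleR_add_left flip: sum_distrib_left scaleR_scaleR scaleR_sum_right)
    then show "f (c *\<^sub>R x) = c *\<^sub>R f x" by (simp add: f_def algebra_simps)
  qed
  then have "f x = adjoint f 1 \<bullet> x" for x
    using adjoint_works[of f x 1] by (simp add: inner_commute)
  then have "barycentric T a x = adjoint f 1 \<bullet> x + barycentric T a 0" for x
    by (metis f_def diff_add_cancel)
  then show thesis using that by blast
qed

lemma simplex_eq_barycentric: "x \<in> T \<longleftrightarrow> (\<forall>a\<in>vertices T. 0 \<le> barycentric T a x)"
proof
  assume "x \<in> T"
  then have "x \<in> convex hull (vertices T)" using simplex_vertices(4)[OF T] by simp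
  then obtain l where "\<forall>a\<in>vertices T. 0 \<le> l a" "sum l (vertices T) = 1" "(\<Sum>w\<in>vertices T. l w *\<^sub>R w) = x"
    unfolding convex_hull_finite[OF simplex_vertices(2)[OF T]] by auto
  then show "\<forall>a\<in>vertices T. 0 \<le> barycentric T a x" using barycentric_eqI by metis
next
  assume "\<forall>a\<in>vertices T. 0 \<le> barycentric T a x"
  then have "x \<in> convex hull (vertices T)"
    unfolding convex_hull_finite[OF simplex_vertices(2)[OF T]] mem_Collect_eq
    by (intro exI[of _ "\<lambda>a. barycentric T a x"]) (simp add: barycentric_works)
  then show "x \<in> T" using simplex_vertices(4)[OF T] by simp
qed

lemma interior_simplex_eq_barycentric: "x \<in> interior T \<longleftrightarrow> (\<forall>a\<in>vertices T. 0 < barycentric T a x)"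
proof -
  have eq: "interior T = {y. \<exists>u. (\<forall>x\<in>vertices T. 0 < u x) \<and> sum u (vertices T) = 1 \<and> (\<Sum>x\<in>vertices T. u x *\<^sub>R x) = y}"
    using interior_convex_hull_explicit_minimal[OF simplex_vertices(1)[OF T]]
      simplex_vertices(3)[OF T] simplex_vertices(4)[OF T, symmetric] by simp
  show ?thesis
  proof
    assume "x \<in> interior T"
    then obtain u where "\<forall>x\<in>vertices T. 0 < u x" "sum u (vertices T) = 1" "(\<Sum>x\<in>vertices T. u x *\<^sub>R x) = x"
      unfolding eq by blast
    then show "\<forall>a\<in>vertices T. 0 < barycentric T a x"
      by (simp add: barycentric_eqI)
  next
    assume "\<forall>a\<in>vertices T. 0 < barycentric T a x"
    then show "x \<in> interior T"
      unfolding eq mem_Collect_eq by (intro exI[of _ "\<lambda>a. barycentric T a x"]) (simp add: barycentric_works)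
  qed
qed

lemma interior_simplex_nonempty: "interior T \<noteq> {}"
proof -
  let ?n = "real (card (vertices T))"
  \<comment> \<open>The barycentre is an interior point.\<close>
  let ?x = "\<Sum>a\<in>vertices T. (1 / ?n) *\<^sub>R a"
  have n: "?n > 0" using simplex_vertices(3)[OF T] by simp
  have "barycentric T a ?x = 1 / ?n" if "a \<in> vertices T" for a
    by (rule barycentric_eqI[OF _ _ that]) (use n in simp_all)
  then have "?x \<in> interior T" unfolding interior_simplex_eq_barycentric using n by simp
  then show ?thesis by blast
qed

text \<open>
  A point of the simplex off its interior has a barycentric coordinate equal to zero.
\<close>
lemma bubble_frontier: "x \<notin> interior T \<Longrightarrow> bubble T x = 0"
  unfolding bubble_def
  using simplex_eq_barycentric[of x] interior_simplex_eq_barycentric[of x] simplex_vertices(2)[OF T]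
  by (auto simp: not_less intro: antisym)

end

text \<open>
  The gradient is kept as an existentially quantified continuous field, so that the product rule can be iterated without an
  explicit formula for many factors.
\<close>
lemma gradient_product:
  fixes f :: "'i \<Rightarrow> 'a::euclidean_space \<Rightarrow> real"
  assumes "finite I" "\<And>i. i \<in> I \<Longrightarrow> \<exists>g. continuous_on UNIV g \<and> (\<forall>x. (f i has_derivative (\<lambda>h. g x \<bullet> h)) (at x))"
  shows "\<exists>g. continuous_on UNIV g \<and> (\<forall>x. ((\<lambda>x. \<Prod>i\<in>I. f i x) has_derivative (\<lambda>h. g x \<bullet> h)) (at x))"
  using assms
proof (induction I)
  case empty
  show ?case by (auto intro!: exI[of _ "\<lambda>x. 0"])
next
  case (insert i I)
  obtain g where g: "continuous_on UNIV g" "\<And>x. (f i has_derivative (\<lambda>h. g x \<bullet> h)) (at x)"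
    using insert.prems[of i] by auto
  obtain G where G: "continuous_on UNIV G" "\<And>x. ((\<lambda>x. \<Prod>i\<in>I. f i x) has_derivative (\<lambda>h. G x \<bullet> h)) (at x)"
    using insert by auto
  have cont: "continuous_on UNIV (f i)" "continuous_on UNIV (\<lambda>x. \<Prod>i\<in>I. f i x)"
    using has_derivative_continuous[OF g(2)] has_derivative_continuous[OF G(2)]
    by (simp_all add: continuous_at_imp_continuous_on)
  have "continuous_on UNIV (\<lambda>x. f i x *\<^sub>R G x + (\<Prod>i\<in>I. f i x) *\<^sub>R g x)"
    by (intro continuous_on_add continuous_on_scaleR cont g(1) G(1))
  moreover have "((\<lambda>x. \<Prod>i\<in>insert i I. f i x) has_derivative
      (\<lambda>h. (f i x *\<^sub>R G x + (\<Prod>i\<in>I. f i x) *\<^sub>R g x) \<bullet> h)) (at x)" for x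
    using has_derivative_mult[OF g(2)[of x] G(2)[of x]] insert(1,2)
    by (simp add: inner_add_left mult.commute)
  ultimately show ?case by blast
qed

lemma barycentric_product_gradient:
  fixes T :: "'a::euclidean_space set"
  assumes T: "int DIM('a) simplex T"
  obtains G where "continuous_on UNIV G"
    "\<And>x. ((\<lambda>x. \<Prod>a\<in>vertices T. barycentric T a x) has_derivative (\<lambda>h. G x \<bullet> h)) (at x)"
proof -
  have "\<exists>g. continuous_on UNIV g \<and> (\<forall>x. (barycentric T a has_derivative (\<lambda>h. g x \<bullet> h)) (at x))"
    if a: "a \<in> vertices T" for a
  proof -
    obtain p q where "\<And>x. barycentric T a x = p \<bullet> x + q"
      using barycentric_affine[OF T a] by metis
    then have "barycentric T a = (\<lambda>x. p \<bullet> x + q)" by (rule ext)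
    then show ?thesis
      by (intro exI[of _ "\<lambda>x. p"]) (auto intro!: derivative_eq_intros)
  qed
  then show thesis using gradient_product[OF simplex_vertices(2)[OF T], of "barycentric T"] that by blast
qed

text \<open>
  A segment that leaves \<open>T\<close> crosses the boundary, where the function is already zero.
\<close>
lemma lipschitz_extend_zero:
  fixes f :: "'a::euclidean_space \<Rightarrow> real"
  assumes T: "closed T" and lip: "L-lipschitz_on T f" and 0: "\<And>x. x \<notin> interior T \<Longrightarrow> f x = 0"
  shows "L-lipschitz_on UNIV f"
proof (rule lipschitz_onI)
  show L: "0 \<le> L" using lip by (rule lipschitz_on_nonneg)
  have mixed: "dist (f x) (f y) \<le> L * dist x y" if x: "x \<in> T" and y: "y \<notin> T" for x y
  proof -
    have "closed_segment x y \<inter> frontier T \<noteq> {}"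
      by (rule connected_Int_frontier) (use x y in auto)
    then obtain z where z: "z \<in> closed_segment x y" "z \<in> frontier T" by blast
    then have "z \<in> T" "z \<notin> interior T" using T by (simp_all add: frontier_def)
    moreover have "f y = 0" using 0 y interior_subset[of T] by blast
    ultimately have "dist (f x) (f y) = dist (f x) (f z)" using 0 by simp
    also have "\<dots> \<le> L * dist x z" by (rule lipschitz_onD[OF lip x \<open>z \<in> T\<close>])
    also have "\<dots> \<le> L * dist x y"
      using dist_in_closed_segment[OF z(1)] L by (intro mult_left_mono) (auto simp: dist_commute)
    finally show ?thesis .
  qed
  show "dist (f x) (f y) \<le> L * dist x y" for x y
  proof -
    consider "x \<in> T" "y \<in> T" | "x \<in> T" "y \<notin> T" | "x \<notin> T" "y \<in> T" | "x \<notin> T" "y \<notin> T" by blast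
    then show ?thesis
    proof cases
      case 1 then show ?thesis by (rule lipschitz_onD[OF lip])
    next
      case 2 then show ?thesis by (rule mixed)
    next
      case 3 then show ?thesis using mixed[of y x] by (simp add: dist_commute)
    next
      case 4
      then have "f x = 0" "f y = 0" using 0 interior_subset by blast+
      then show ?thesis using L by simp
    qed
  qed
qed

lemma negligible_convex_diff_interior:
  fixes T :: "'a::euclidean_space set"
  assumes "convex T" "closed T"
  shows "negligible (T - interior T)"
  using negligible_convex_frontier[OF assms(1)] assms(2) by (simp add: frontier_def)

text \<open>
  The bubble extended by zero is Lipschitz on the whole space and differentiable off the boundary of the simplex, with
  derivative zero outside, so the integral over the simplex is the integral over the whole space.
\<close>
lemma integral_bubble_gradient_eq_0:
  fixes T :: "'a::euclidean_space set"
  assumes T: "int DIM('a) simplex T" and G: "continuous_on UNIV G"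
    and der: "\<And>x. ((\<lambda>x. \<Prod>a\<in>vertices T. barycentric T a x) has_derivative (\<lambda>h. G x \<bullet> h)) (at x)"
  shows "(LINT x|lebesgue_on T. G x \<bullet> e) = 0"
proof -
  note cc = simplex_compact_convex[OF T]
  have clT: "closed T" using cc compact_imp_closed by blast
  have Ts: "T \<in> sets lebesgue" using cc by (simp add: borel_compact)
  have cont: "continuous_on S G" for S using G continuous_on_subset by blast
  have "bounded (G ` T)"
    using compact_continuous_image[OF cont cc(1)] compact_imp_bounded by blast
  then obtain B0 where B0: "\<And>x. x \<in> T \<Longrightarrow> norm (G x) \<le> B0" unfolding bounded_iff by auto
  define B where "B = max B0 0"
  have B: "0 \<le> B" "\<And>x. x \<in> T \<Longrightarrow> norm (G x) \<le> B" using B0 by (force simp: B_def)+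
  have "B-lipschitz_on T (bubble T)"
  proof (rule lipschitz_onI[OF _ B(1)])
    fix x y assume xy: "x \<in> T" "y \<in> T"
    have on: "onorm (\<lambda>h. G z \<bullet> h) \<le> B" if "z \<in> T" for z
    proof (rule onorm_bound[OF B(1)])
      fix h show "norm (G z \<bullet> h) \<le> B * norm h"
        using Cauchy_Schwarz_ineq2[of "G z" h] mult_right_mono[OF B(2)[OF that], of "norm h"] by simp
    qed
    have "norm ((\<Prod>a\<in>vertices T. barycentric T a x) - (\<Prod>a\<in>vertices T. barycentric T a y)) \<le> B * norm (x - y)"
      by (rule differentiable_bound[OF cc(2) _ on xy]) (rule has_derivative_at_withinI[OF der])
    then show "dist (bubble T x) (bubble T y) \<le> B * dist x y"
      using xy by (simp add: bubble_def dist_norm)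
  qed
  then have lip: "B-lipschitz_on UNIV (bubble T)"
    by (rule lipschitz_extend_zero[OF clT]) (rule bubble_frontier[OF T])
  let ?D = "\<lambda>x. if x \<in> T then G x \<bullet> e else 0"
  have "integral\<^sup>L lebesgue ?D = 0"
  proof (rule integral_directional_derivative_eq_0[OF lip, of T _ e])
    show "bubble T x = 0" if "x \<notin> T" for x using that by (simp add: bubble_def)
    show "bounded T" using cc compact_imp_bounded by blast
    have "(\<lambda>x. G x \<bullet> e) \<in> borel_measurable (lebesgue_on T)"
      by (intro continuous_imp_measurable_on_sets_lebesgue continuous_intros cont Ts)
    then show "?D \<in> borel_measurable lebesgue" using Ts by (rule borel_measurable_if_I)
    have "AE x in lebesgue. x \<notin> T - interior T"
      by (intro AE_notin_negligible negligible_convex_diff_interior cc clT)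
    then show "AE x in lebesgue. \<exists>\<psi>'. (bubble T has_derivative \<psi>') (at x) \<and> \<psi>' e = ?D x"
    proof eventually_elim
      case (elim x)
      show ?case
      proof (cases "x \<in> T")
        case True
        then have x: "x \<in> interior T" using elim by blast
        have "(bubble T has_derivative (\<lambda>h. G x \<bullet> h)) (at x)"
          by (rule has_derivative_transform_within_open[OF der open_interior x])
            (use interior_subset[of T] in \<open>auto simp: bubble_def\<close>)
        then show ?thesis using True by auto
      next
        case False
        have "(bubble T has_derivative (\<lambda>h. 0)) (at x)"
          by (rule has_derivative_transform_within_open[OF has_derivative_const[of 0], of "- T"])
            (use False clT in \<open>auto simp: bubble_def\<close>)
        then show ?thesis using False by (intro exI[of _ "\<lambda>h. 0"]) auto
      qed
    qed
  qed
  then show ?thesis using Ts by (simp add: Lebesgue_Measure.integral_restrict_UNIV)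
qed

lemma has_weak_gradient_affine:
  fixes a :: "'a::euclidean_space"
  assumes "\<And>x. x \<in> T \<Longrightarrow> v x = a \<bullet> x + b"
  shows "has_weak_gradient (interior T) v (\<lambda>x. a)"
proof -
  have "has_weak_gradient (interior T) (\<lambda>x. a \<bullet> x + b) (\<lambda>x. a)"
    by (rule has_weak_gradient_classical) (auto intro!: derivative_eq_intros)
  then show ?thesis
    by (rule has_weak_gradient_cong) (use assms interior_subset[of T] in \<open>simp add: subset_iff\<close>)
qed

lemma H1_seminorm_affine:
  fixes T :: "'a::euclidean_space set"
  assumes T: "compact T" "convex T" and v: "\<And>x. x \<in> T \<Longrightarrow> v x = a \<bullet> x + b"
  shows "H1_seminorm T v = L2_norm T (\<lambda>x. a)"
  using T by (intro H1_seminorm_eq has_weak_gradient_affine[OF v] negligible_convex_diff_interior)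
    (auto simp: borel_compact compact_imp_closed)

text \<open>
  The gradient of \<open>v\<close> is a constant \<open>a\<close> and the gradient \<open>G\<close> of the bubble has mean value zero. Hence in
  \<open>\<bar>a + c G\<bar>\<^sup>2 = \<bar>a\<bar>\<^sup>2 + 2 c (a \<bullet> G) + c\<^sup>2 \<bar>G\<bar>\<^sup>2\<close> the mixed term integrates to zero and the last term is nonnegative.
\<close>
lemma H1_seminorm_affine_le_add_bubble:
  fixes T :: "'a::euclidean_space set"
  assumes T: "int DIM('a) simplex T" and v: "v \<in> P1 T"
    and w: "\<And>x. x \<in> T \<Longrightarrow> w x = v x + c * bubble T x"
  shows "H1_seminorm T v \<le> H1_seminorm T w"
proof -
  note cc = simplex_compact_convex[OF T]
  have Ts: "T \<in> sets lebesgue" and clT: "closed T" using cc by (auto simp: borel_compact compact_imp_closed)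
  obtain a b where ab: "\<And>x. x \<in> T \<Longrightarrow> v x = a \<bullet> x + b" using v by (auto simp: P1_def)
  obtain G where G: "continuous_on UNIV G" and
    der: "\<And>x. ((\<lambda>x. \<Prod>a\<in>vertices T. barycentric T a x) has_derivative (\<lambda>h. G x \<bullet> h)) (at x)"
    using barycentric_product_gradient[OF T] by metis
  have cont: "continuous_on S G" for S using G continuous_on_subset by blast
  let ?g = "\<lambda>x. a + c *\<^sub>R G x"
  let ?P = "\<lambda>x. \<Prod>a\<in>vertices T. barycentric T a x"
  have "has_weak_gradient (interior T) (\<lambda>x. (a \<bullet> x + b) + c * ?P x) ?g"
  proof (rule has_weak_gradient_classical[OF open_interior])
    fix x
    have aff: "((\<lambda>x. a \<bullet> x + b) has_derivative (\<lambda>h. a \<bullet> h)) (at x)"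
      by (auto intro!: derivative_eq_intros)
    show "((\<lambda>x. (a \<bullet> x + b) + c * ?P x) has_derivative (\<lambda>h. ?g x \<bullet> h)) (at x)"
      using has_derivative_add[OF aff has_derivative_mult_right[OF der[of x], of c]]
      by (simp add: inner_add_left)
  qed (intro continuous_intros cont)
  then have "has_weak_gradient (interior T) w ?g"
    by (rule has_weak_gradient_cong) (use w ab interior_subset[of T] in \<open>simp add: bubble_def subset_iff\<close>)
  then have wn: "H1_seminorm T w = L2_norm T ?g"
    using Ts cc clT
    by (intro H1_seminorm_eq negligible_convex_diff_interior continuous_imp_measurable_on_sets_lebesgue
        continuous_intros cont)
  have "(L2_norm T (\<lambda>x. a))\<^sup>2 = (LINT x|lebesgue_on T. (norm a)\<^sup>2 + 2 * c * (G x \<bullet> a))"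
  proof -
    have "integrable (lebesgue_on T) (\<lambda>x. (norm a)\<^sup>2)" "integrable (lebesgue_on T) (\<lambda>x. G x \<bullet> a)"
      by (intro integrable_continuous_compact cc continuous_intros cont)+
    then have "(LINT x|lebesgue_on T. (norm a)\<^sup>2 + 2 * c * (G x \<bullet> a))
        = (LINT x|lebesgue_on T. (norm a)\<^sup>2) + 2 * c * (LINT x|lebesgue_on T. G x \<bullet> a)"
      by simp
    then show ?thesis
      using integral_bubble_gradient_eq_0[OF T G der] by (simp add: L2_norm_power2)
  qed
  also have "\<dots> \<le> (LINT x|lebesgue_on T. (norm (?g x))\<^sup>2)"
  proof (rule integral_mono)
    show "integrable (lebesgue_on T) (\<lambda>x. (norm a)\<^sup>2 + 2 * c * (G x \<bullet> a))"
      "integrable (lebesgue_on T) (\<lambda>x. (norm (?g x))\<^sup>2)"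
      by (intro integrable_continuous_compact cc continuous_intros cont)+
    show "(norm a)\<^sup>2 + 2 * c * (G x \<bullet> a) \<le> (norm (?g x))\<^sup>2" for x
    proof -
      have "(norm (?g x))\<^sup>2 = (norm a)\<^sup>2 + 2 * c * (G x \<bullet> a) + c\<^sup>2 * (norm (G x))\<^sup>2"
        unfolding power2_norm_eq_inner
        by (simp add: inner_add_left inner_add_right inner_commute power2_eq_square algebra_simps)
      then show ?thesis by simp
    qed
  qed
  also have "\<dots> = (L2_norm T ?g)\<^sup>2" by (simp add: L2_norm_power2)
  finally have "L2_norm T (\<lambda>x. a) \<le> L2_norm T ?g" by (rule power2_le_imp_le) simp
  then show ?thesis using wn H1_seminorm_affine[OF cc ab] by simp
qed

lemma conforming_triangulation_simplex:
  fixes \<T> :: "'a::euclidean_space set set"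
  shows "conforming_triangulation \<Omega> \<T> \<Longrightarrow> T \<in> \<T> \<Longrightarrow> int DIM('a) simplex T"
  by (simp add: conforming_triangulation_def)

text \<open>
  Conformity makes the intersection of two elements a face of both. It is a proper face of \<open>T'\<close>, since otherwise \<open>T'\<close>
  would itself be a proper face of \<open>T\<close> and would miss the interior of \<open>T\<close>, although its own interior is not empty. A proper face avoids
  the interior, where the bubble lives.
\<close>
lemma bubble_eq_0_on_other_element:
  fixes \<T> :: "'a::euclidean_space set set"
  assumes mesh: "conforming_triangulation \<Omega> \<T>" and T: "T \<in> \<T>" "T' \<in> \<T>" "T \<noteq> T'" and x: "x \<in> T"
  shows "bubble T' x = 0"
proof (rule bubble_frontier[OF conforming_triangulation_simplex[OF mesh T(2)]])
  have face: "(T \<inter> T') face_of T" "(T' \<inter> T) face_of T'"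
    using mesh T by (auto simp: conforming_triangulation_def triangulation_def)
  have "T' \<inter> T \<noteq> T'"
  proof
    assume eq: "T' \<inter> T = T'"
    then have "T' face_of T" using face(1) by (simp add: Int_commute)
    then have "T' \<inter> interior T = {}" using face_of_disjoint_interior T(3) by blast
    moreover have "interior T' \<subseteq> T' \<inter> interior T"
      using eq interior_mono[of T' T] interior_subset[of T'] by blast
    ultimately show False
      using interior_simplex_nonempty[OF conforming_triangulation_simplex[OF mesh T(2)]] by blast
  qed
  then have "(T' \<inter> T) \<inter> interior T' = {}" using face_of_disjoint_interior[OF face(2)] by blast
  then show "x \<notin> interior T'" using x interior_subset[of T'] by blast
qed

lemma Vb_on_element:
  assumes mesh: "conforming_triangulation \<Omega> \<T>" and T: "T \<in> \<T>" and vb: "vb \<in> Vb \<T>"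
  obtains c where "\<And>x. x \<in> T \<Longrightarrow> vb x = c * bubble T x"
proof -
  obtain c where c: "vb = (\<lambda>x. \<Sum>T\<in>\<T>. c T * bubble T x)" using vb by (auto simp: Vb_def)
  have fin: "finite \<T>" using mesh by (simp add: conforming_triangulation_def triangulation_def)
  have "vb x = c T * bubble T x" if x: "x \<in> T" for x
  proof -
    have "(\<Sum>T'\<in>\<T> - {T}. c T' * bubble T' x) = 0"
      by (intro sum.neutral) (use bubble_eq_0_on_other_element[OF mesh T _ _ x] in auto)
    then show ?thesis unfolding c using sum.remove[OF fin T, of "\<lambda>T. c T * bubble T x"] by simp
  qed
  then show thesis using that by blast
qed

lemma Vb_outside: "vb \<in> Vb \<T> \<Longrightarrow> x \<notin> \<Union>\<T> \<Longrightarrow> vb x = 0"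
  by (auto simp: Vb_def bubble_def intro!: sum.neutral)

text \<open>
  The bubble vanishes at the vertices, and an affine function is determined by its values there.
\<close>
lemma affine_eq_bubble_imp_0:
  fixes T :: "'a::euclidean_space set"
  assumes T: "int DIM('a) simplex T" and eq: "\<And>x. x \<in> T \<Longrightarrow> a \<bullet> x + b = c * bubble T x" and x: "x \<in> T"
  shows "a \<bullet> x + b = 0"
proof -
  have v: "a \<bullet> w + b = 0" if w: "w \<in> vertices T" for w
  proof -
    have "w extreme_point_of T" using w by (simp add: vertices_def)
    then have "w \<notin> interior T" "w \<in> T"
      using extreme_point_not_in_interior by (auto simp: extreme_point_of_def)
    then show ?thesis using eq bubble_frontier[OF T] by simp
  qed
  have "a \<bullet> x + b = a \<bullet> (\<Sum>w\<in>vertices T. barycentric T w x *\<^sub>R w) + b * (\<Sum>w\<in>vertices T. barycentric T w x)"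
    using barycentric_works[OF T] by simp
  also have "\<dots> = (\<Sum>w\<in>vertices T. barycentric T w x * (a \<bullet> w + b))"
    by (simp add: inner_sum_right sum_distrib_left sum.distrib algebra_simps)
  also have "\<dots> = 0" using v by simp
  finally show ?thesis .
qed

text \<open>
  Equality holds at every point of the space: outside the mesh all bubbles vanish, and on an element the difference of
  the discrete parts is an affine multiple of the bubble.
\<close>
lemma Vhb0_decomposition_unique:
  fixes \<T> :: "'a::euclidean_space set set"
  assumes mesh: "conforming_triangulation \<Omega> \<T>" and vh: "vh \<in> Vh0 \<Omega> \<T>" "vh' \<in> Vh0 \<Omega> \<T>"
    and vb: "vb \<in> Vb \<T>" "vb' \<in> Vb \<T>" and eq: "\<And>x. vh x + vb x = vh' x + vb' x"
  shows "vh = vh'"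
proof
  fix x
  show "vh x = vh' x"
  proof (cases "x \<in> \<Union>\<T>")
    case False
    then show ?thesis using eq[of x] Vb_outside[OF vb(1) False] Vb_outside[OF vb(2) False] by simp
  next
    case True
    then obtain T where T: "T \<in> \<T>" "x \<in> T" by blast
    obtain a b where ab: "\<And>x. x \<in> T \<Longrightarrow> vh x = a \<bullet> x + b" using vh T by (auto simp: Vh0_def P1_def)
    obtain a' b' where ab': "\<And>x. x \<in> T \<Longrightarrow> vh' x = a' \<bullet> x + b'" using vh T by (auto simp: Vh0_def P1_def)
    obtain c where c: "\<And>x. x \<in> T \<Longrightarrow> vb x = c * bubble T x" using Vb_on_element[OF mesh T(1) vb(1)] by metis
    obtain c' where c': "\<And>x. x \<in> T \<Longrightarrow> vb' x = c' * bubble T x" using Vb_on_element[OF mesh T(1) vb(2)] by metis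
    have "(a - a') \<bullet> y + (b - b') = (c' - c) * bubble T y" if "y \<in> T" for y
      using eq[of y] ab[OF that] ab'[OF that] c[OF that] c'[OF that] by (simp add: algebra_simps inner_diff_left)
    from affine_eq_bubble_imp_0[OF conforming_triangulation_simplex[OF mesh T(1)] this T(2)]
    show ?thesis using ab T ab' by (simp add: inner_diff_left)
  qed
qed

lemma kappa_eq:
  fixes \<T> :: "'a::euclidean_space set set"
  assumes mesh: "conforming_triangulation \<Omega> \<T>" and vh: "vh \<in> Vh0 \<Omega> \<T>" and vb: "vb \<in> Vb \<T>"
  shows "kappa \<Omega> \<T> (\<lambda>x. vh x + vb x) = vh"
  unfolding kappa_def
proof (rule the_equality)
  show "vh \<in> Vh0 \<Omega> \<T> \<and> (\<exists>vb'\<in>Vb \<T>. (\<lambda>x. vh x + vb x) = (\<lambda>x. vh x + vb' x))" using vh vb by blast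
  fix w assume w: "w \<in> Vh0 \<Omega> \<T> \<and> (\<exists>vb'\<in>Vb \<T>. (\<lambda>x. vh x + vb x) = (\<lambda>x. w x + vb' x))"
  then obtain wb where wb: "wb \<in> Vb \<T>" "\<And>x. w x + wb x = vh x + vb x" by (metis (mono_tags))
  then show "w = vh" using Vhb0_decomposition_unique[OF mesh _ vh wb(1) vb] w by blast
qed

lemma Vh0_diff:
  assumes "open \<Omega>" "u \<in> Vh0 \<Omega> \<T>" "v \<in> Vh0 \<Omega> \<T>"
  shows "(\<lambda>x. u x - v x) \<in> Vh0 \<Omega> \<T>"
proof -
  have "(\<lambda>x. u x - v x) \<in> P1 T" if T: "T \<in> \<T>" for T
  proof -
    have "u \<in> P1 T" "v \<in> P1 T" using assms T by (simp_all add: Vh0_def)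
    then obtain a b a' b' where ab: "\<forall>x\<in>T. u x = a \<bullet> x + b" and ab': "\<forall>x\<in>T. v x = a' \<bullet> x + b'"
      unfolding P1_def by blast
    have "\<forall>x\<in>T. u x - v x = (a - a') \<bullet> x + (b - b')" using ab ab' by (simp add: inner_diff_left)
    then show ?thesis unfolding P1_def by blast
  qed
  then show ?thesis using H10_diff[OF assms(1)] assms(2,3) by (auto simp: Vh0_def)
qed

lemma Vb_diff:
  assumes "u \<in> Vb \<T>" "v \<in> Vb \<T>"
  shows "(\<lambda>x. u x - v x) \<in> Vb \<T>"
proof -
  obtain c d where "u = (\<lambda>x. \<Sum>T\<in>\<T>. c T * bubble T x)" "v = (\<lambda>x. \<Sum>T\<in>\<T>. d T * bubble T x)"
    using assms by (auto simp: Vb_def)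
  then have "(\<lambda>x. u x - v x) = (\<lambda>x. \<Sum>T\<in>\<T>. (c T - d T) * bubble T x)"
    by (simp add: left_diff_distrib sum_subtractf)
  then show ?thesis by (auto simp: Vb_def)
qed

section \<open>Restriction of the data and estimates on one element\<close>

text \<open>
  The boundary is a finite union of lower-dimensional convex sets. This makes elements of the closed mesh, which may touch the
  boundary of the domain, subsets of the open domain up to null sets.
\<close>
lemma negligible_polyhedral_boundary:
  fixes \<Omega> :: "'a::euclidean_space set"
  assumes "polyhedral_boundary \<Omega>"
  shows "negligible (frontier \<Omega>)"
proof -
  obtain F where F: "finite F" "\<And>P. P \<in> F \<Longrightarrow> polytope P \<and> aff_dim P = int DIM('a) - 1" "frontier \<Omega> = \<Union>F"
    using assms unfolding polyhedral_boundary_def by blast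
  have "negligible P" if "P \<in> F" for P
  proof -
    have "interior P = {}" using F(2)[OF that] aff_dim_nonempty_interior[of P] by force
    then show ?thesis using F(2)[OF that] polytope_imp_convex negligible_convex_interior by blast
  qed
  then show ?thesis using F by (auto intro!: negligible_Union)
qed

lemma borel_measurable_lebesgue_on_transfer:
  fixes f :: "'a::euclidean_space \<Rightarrow> 'b::euclidean_space"
  assumes f: "f \<in> borel_measurable (lebesgue_on \<Omega>)" and T: "T \<in> sets lebesgue" "negligible (T - \<Omega>)"
  shows "f \<in> borel_measurable (lebesgue_on T)"
proof -
  have "T - \<Omega> \<in> null_sets (lebesgue_on T)"
    using T by (simp add: null_sets_restrict_space negligible_iff_null_sets)
  moreover have "f \<in> borel_measurable (lebesgue_on (T - (T - \<Omega>)))"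
    by (rule measurable_restrict_mono[OF f]) auto
  ultimately show ?thesis using borel_measurable_diff_null T by blast
qed

lemma AE_lebesgue_on_transfer:
  assumes P: "AE x in lebesgue_on \<Omega>. P x" and \<Omega>: "\<Omega> \<in> sets lebesgue" and T: "T \<in> sets lebesgue" "negligible (T - \<Omega>)"
  shows "AE x in lebesgue_on T. P x"
proof -
  have "AE x in lebesgue. x \<in> \<Omega> \<longrightarrow> P x" using P \<Omega> by (simp add: AE_lebesgue_on_iff)
  moreover have "AE x in lebesgue. x \<notin> T - \<Omega>" by (rule AE_notin_negligible[OF T(2)])
  ultimately have "AE x in lebesgue. x \<in> T \<longrightarrow> P x" by eventually_elim auto
  then show ?thesis using T by (simp add: AE_lebesgue_on_iff)
qed

lemma L2_transfer:
  fixes f :: "'a::euclidean_space \<Rightarrow> 'b::euclidean_space"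
  assumes f: "f \<in> L2 \<Omega>" and \<Omega>: "\<Omega> \<in> sets lebesgue" and T: "T \<in> sets lebesgue" "negligible (T - \<Omega>)"
  shows "f \<in> L2 T" "L2_norm T f \<le> L2_norm \<Omega> f"
proof -
  let ?I = "\<lambda>S x. if x \<in> S then (norm (f x))\<^sup>2 else 0"
  have m: "f \<in> borel_measurable (lebesgue_on T)"
    by (rule borel_measurable_lebesgue_on_transfer[OF L2_measurable[OF f] T])
  then have mT: "?I T \<in> borel_measurable lebesgue"
    by (intro borel_measurable_if_I[OF _ T(1)]) measurable
  have int: "integrable lebesgue (?I \<Omega>)"
    unfolding Lebesgue_Measure.integrable_restrict_UNIV[OF \<Omega>] by (rule L2_integrable[OF f])
  have le: "AE x in lebesgue. ?I T x \<le> ?I \<Omega> x"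
    using AE_notin_negligible[OF T(2)] by eventually_elim auto
  have "integrable lebesgue (?I T)"
  proof (rule Bochner_Integration.integrable_bound[OF int mT])
    have "norm (?I T x) \<le> norm (?I \<Omega> x)" if "?I T x \<le> ?I \<Omega> x" for x using that by simp
    then show "AE x in lebesgue. norm (?I T x) \<le> norm (?I \<Omega> x)" using le by (rule eventually_mono[rotated])
  qed
  then have "integrable (lebesgue_on T) (\<lambda>x. (norm (f x))\<^sup>2)"
    unfolding Lebesgue_Measure.integrable_restrict_UNIV[OF T(1)] .
  then show "f \<in> L2 T" using m by (simp add: L2_def)
  have "integral\<^sup>L lebesgue (?I T) \<le> integral\<^sup>L lebesgue (?I \<Omega>)"
    by (rule integral_mono_AE'[OF int le]) simp
  then show "L2_norm T f \<le> L2_norm \<Omega> f"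
    unfolding L2_norm_def
    unfolding Lebesgue_Measure.integral_restrict_UNIV[OF \<Omega>] Lebesgue_Measure.integral_restrict_UNIV[OF T(1)]
    by (rule real_sqrt_le_mono)
qed

lemma W1_infty_field_bounded:
  fixes \<beta> :: "'a::euclidean_space \<Rightarrow> 'a"
  assumes "\<beta> \<in> W1_infty_field \<Omega>"
  shows "\<beta> \<in> borel_measurable (lebesgue_on \<Omega>)" "\<exists>B. AE x in lebesgue_on \<Omega>. norm (\<beta> x) \<le> B"
proof -
  have c: "(\<lambda>x. \<beta> x \<bullet> i) \<in> Linfty \<Omega>" if "i \<in> Basis" for i
    using assms that by (simp add: W1_infty_field_def W1_infty_def)
  then show "\<beta> \<in> borel_measurable (lebesgue_on \<Omega>)"
    using borel_measurable_euclidean_space by (auto simp: Linfty_def)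
  have "\<forall>i\<in>Basis. \<exists>C. AE x in lebesgue_on \<Omega>. \<bar>\<beta> x \<bullet> i\<bar> \<le> C"
    using c by (simp add: Linfty_def)
  then obtain C where C: "\<And>i. i \<in> Basis \<Longrightarrow> AE x in lebesgue_on \<Omega>. \<bar>\<beta> x \<bullet> i\<bar> \<le> C i" by metis
  have "AE x in lebesgue_on \<Omega>. \<forall>i\<in>Basis. \<bar>\<beta> x \<bullet> i\<bar> \<le> C i"
    by (intro AE_finite_allI C) simp
  then have "AE x in lebesgue_on \<Omega>. norm (\<beta> x) \<le> (\<Sum>i\<in>Basis. C i)"
  proof eventually_elim
    case (elim x)
    have "norm (\<beta> x) \<le> (\<Sum>i\<in>Basis. \<bar>\<beta> x \<bullet> i\<bar>)" by (rule norm_le_l1)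
    also have "\<dots> \<le> (\<Sum>i\<in>Basis. C i)" using elim by (intro sum_mono) auto
    finally show ?case .
  qed
  then show "\<exists>B. AE x in lebesgue_on \<Omega>. norm (\<beta> x) \<le> B" by blast
qed

text \<open>
  The real-valued norm is read off an extended essential supremum, which is \<open>- \<infinity>\<close> on null sets and may be \<open>\<infinity>\<close> for unbounded
  functions. The nonempty interior and the bound \<open>B\<close> exclude both cases.
\<close>
lemma Linfty_norm_bounds:
  fixes \<beta> :: "'a::euclidean_space \<Rightarrow> 'b::euclidean_space"
  assumes T: "T \<in> sets lebesgue" "interior T \<noteq> {}" and \<beta>: "\<beta> \<in> borel_measurable (lebesgue_on T)"
    and B: "AE x in lebesgue_on T. norm (\<beta> x) \<le> B"
  shows "0 \<le> Linfty_norm T \<beta>" "Linfty_norm T \<beta> \<le> B" "AE x in lebesgue_on T. norm (\<beta> x) \<le> Linfty_norm T \<beta>"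
proof -
  let ?E = "esssup (lebesgue_on T) (\<lambda>x. ereal (norm (\<beta> x)))"
  have upper: "?E \<le> ereal B"
    by (rule esssup_I) (use \<beta> B in auto)
  have ae: "AE x in lebesgue_on T. ereal (norm (\<beta> x)) \<le> ?E" by (rule esssup_AE)
  have lower: "0 \<le> ?E"
  proof (rule ccontr)
    assume "\<not> 0 \<le> ?E"
    then have neg: "?E < 0" by simp
    have "AE x in lebesgue_on T. False"
      using ae
    proof eventually_elim
      case (elim x)
      have "ereal (norm (\<beta> x)) < 0" using elim neg by (rule le_less_trans)
      then show ?case by simp
    qed
    then have "AE x in lebesgue. x \<notin> T" using T by (simp add: AE_lebesgue_on_iff)
    then have "negligible T"
      using AE_iff_null_sets[OF T(1)] negligible_iff_null_sets by blast
    then show False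
      using open_not_negligible[OF open_interior T(2)] negligible_subset interior_subset by blast
  qed
  obtain e where e: "?E = ereal e" using upper lower by (cases ?E) auto
  then have L: "Linfty_norm T \<beta> = e" by (simp add: Linfty_norm_def)
  show "0 \<le> Linfty_norm T \<beta>" "Linfty_norm T \<beta> \<le> B" using upper lower e L by simp_all
  show "AE x in lebesgue_on T. norm (\<beta> x) \<le> Linfty_norm T \<beta>" using ae e L by simp
qed

text \<open>
  The difference equals \<open>((\<rho> - \<rho>') + \<rho>' / (\<nu>' + \<tau>) * (\<nu>' - \<nu>)) / (\<nu> + \<tau>)\<close>. The growth condition bounds the
  factor \<open>\<rho>' / (\<nu>' + \<tau>)\<close> by \<open>q\<close>, and the remaining denominator is at least \<open>\<tau>\<close>.
\<close>
lemma quotient_Lipschitz: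
  fixes \<rho> \<rho>' \<nu> \<nu>' \<tau> A q \<delta> :: real
  assumes "\<bar>\<rho> - \<rho>'\<bar> \<le> A * \<delta>" "\<rho>' \<le> q * (\<nu>' + \<tau>)" "0 \<le> \<rho>'" "\<bar>\<nu> - \<nu>'\<bar> \<le> \<delta>"
    "0 \<le> \<nu>" "0 \<le> \<nu>'" "0 < \<tau>" "0 \<le> q"
  shows "\<bar>\<rho> / (\<nu> + \<tau>) - \<rho>' / (\<nu>' + \<tau>)\<bar> \<le> (A + q) * \<delta> / \<tau>"
proof -
  have pos: "\<nu> + \<tau> > 0" "\<nu>' + \<tau> > 0" using assms by auto
  have "\<rho> / (\<nu> + \<tau>) - \<rho>' / (\<nu>' + \<tau>) = ((\<rho> - \<rho>') + \<rho>' / (\<nu>' + \<tau>) * (\<nu>' - \<nu>)) / (\<nu> + \<tau>)"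
    using pos by (simp add: field_simps)
  then have "\<bar>\<rho> / (\<nu> + \<tau>) - \<rho>' / (\<nu>' + \<tau>)\<bar> = \<bar>(\<rho> - \<rho>') + \<rho>' / (\<nu>' + \<tau>) * (\<nu>' - \<nu>)\<bar> / (\<nu> + \<tau>)"
    using pos by (simp add: abs_divide)
  also have "\<dots> \<le> ((A + q) * \<delta>) / (\<nu> + \<tau>)"
  proof (rule divide_right_mono)
    have "\<rho>' / (\<nu>' + \<tau>) \<le> q" using assms pos by (simp add: pos_divide_le_eq)
    moreover have "0 \<le> \<rho>' / (\<nu>' + \<tau>)" using assms pos by simp
    ultimately have "\<bar>\<rho>' / (\<nu>' + \<tau>) * (\<nu>' - \<nu>)\<bar> \<le> q * \<delta>"
      using assms unfolding abs_mult by (intro mult_mono) (auto simp: abs_minus_commute)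
    then show "\<bar>(\<rho> - \<rho>') + \<rho>' / (\<nu>' + \<tau>) * (\<nu>' - \<nu>)\<bar> \<le> (A + q) * \<delta>"
      using assms(1) abs_triangle_ineq[of "\<rho> - \<rho>'" "\<rho>' / (\<nu>' + \<tau>) * (\<nu>' - \<nu>)"]
      by (simp add: distrib_right)
  qed (use pos in simp)
  also have "\<dots> \<le> (A + q) * \<delta> / \<tau>"
  proof (rule divide_left_mono)
    have "0 \<le> A * \<delta>" "0 \<le> q * \<delta>" using assms by (auto intro: mult_nonneg_nonneg order_trans[OF abs_ge_zero])
    then show "0 \<le> (A + q) * \<delta>" by (simp add: distrib_right)
  qed (use assms pos in auto)
  finally show ?thesis .
qed

lemma sqrt_sum_squares_reverse_triangle:
  fixes p q r s :: real
  shows "\<bar>sqrt (p\<^sup>2 + q\<^sup>2) - sqrt (r\<^sup>2 + s\<^sup>2)\<bar> \<le> sqrt ((p - r)\<^sup>2 + (q - s)\<^sup>2)"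
  using real_sqrt_sum_squares_triangle_ineq[of "p - r" r "q - s" s]
    real_sqrt_sum_squares_triangle_ineq[of "r - p" p "s - q" q]
  by (simp add: power2_commute)

lemma Cauchy_Schwarz_pair:
  fixes p q r s :: real
  shows "p * r + q * s \<le> sqrt (p\<^sup>2 + q\<^sup>2) * sqrt (r\<^sup>2 + s\<^sup>2)"
proof -
  have "(p * r + q * s)\<^sup>2 + (p * s - q * r)\<^sup>2 = (p\<^sup>2 + q\<^sup>2) * (r\<^sup>2 + s\<^sup>2)"
    by (simp add: power2_eq_square algebra_simps)
  then have "(p * r + q * s)\<^sup>2 \<le> (p\<^sup>2 + q\<^sup>2) * (r\<^sup>2 + s\<^sup>2)"
    by (metis add_increasing2 order_refl zero_le_power2)
  then show ?thesis unfolding real_sqrt_mult[symmetric] by (rule real_le_rsqrt)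
qed

lemma P1_diff:
  assumes "u \<in> P1 T" "v \<in> P1 T"
  shows "(\<lambda>x. u x - v x) \<in> P1 T"
proof -
  obtain a b a' b' where ab: "\<forall>x\<in>T. u x = a \<bullet> x + b" and ab': "\<forall>x\<in>T. v x = a' \<bullet> x + b'"
    using assms unfolding P1_def by blast
  have "\<forall>x\<in>T. u x - v x = (a - a') \<bullet> x + (b - b')" using ab ab' by (simp add: inner_diff_left)
  then show ?thesis unfolding P1_def by blast
qed

lemma elem_norm_nonneg [simp]: "0 \<le> elem_norm \<sigma> T v"
  by (simp add: elem_norm_def)

lemma elem_norm_le_H1_norm: "elem_norm \<sigma> T v \<le> H1_norm T v"
  by (simp add: elem_norm_def H1_seminorm_le_norm)

context
  fixes T :: "'a::euclidean_space set"
  assumes cT: "compact T" and vT: "convex T"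
begin

lemma element_measurable: "T \<in> sets lebesgue"
  using cT by (simp add: borel_compact)

lemma P1_weak_grad:
  assumes "\<And>x. x \<in> T \<Longrightarrow> v x = a \<bullet> x + b"
  shows "AE x in lebesgue_on T. weak_grad (interior T) v x = a"
proof -
  have "AE x in lebesgue_on T. a = weak_grad (interior T) v x"
    by (rule weak_grad_AE_eq_on[OF element_measurable negligible_convex_diff_interior has_weak_gradient_affine[OF assms]])
      (use cT vT in \<open>simp_all add: compact_imp_closed\<close>)
  then show ?thesis by eventually_elim simp
qed

lemma P1_L2:
  assumes "v \<in> P1 T"
  shows "v \<in> L2 T"
proof -
  obtain a b where ab: "\<forall>x\<in>T. v x = a \<bullet> x + b" using assms unfolding P1_def by blast
  have "continuous_on T (\<lambda>x. a \<bullet> x + b)" by (intro continuous_intros)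
  then have "continuous_on T v" by (rule continuous_on_cong[THEN iffD2, rotated 2]) (use ab in auto)
  then show ?thesis by (rule L2_continuous_compact[OF cT])
qed

lemma elem_norm_reverse_triangle:
  assumes u: "u \<in> P1 T" and v: "v \<in> P1 T"
  shows "\<bar>elem_norm \<sigma> T u - elem_norm \<sigma> T v\<bar> \<le> elem_norm \<sigma> T (\<lambda>x. u x - v x)"
proof -
  obtain a b a' b' where ab: "\<forall>x\<in>T. u x = a \<bullet> x + b" and ab': "\<forall>x\<in>T. v x = a' \<bullet> x + b'"
    using assms unfolding P1_def by blast
  have d: "\<forall>x\<in>T. u x - v x = (a - a') \<bullet> x + (b - b')" using ab ab' by (simp add: inner_diff_left)
  have const: "(\<lambda>x. c) \<in> L2 T" for c :: 'a by (intro L2_continuous_compact cT continuous_intros)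
  have semi: "\<bar>H1_seminorm T u - H1_seminorm T v\<bar> \<le> H1_seminorm T (\<lambda>x. u x - v x)"
    using L2_norm_reverse_triangle[OF const const, of a a'] ab ab' d
      H1_seminorm_affine[OF cT vT, of u a b] H1_seminorm_affine[OF cT vT, of v a' b']
      H1_seminorm_affine[OF cT vT, of "\<lambda>x. u x - v x" "a - a'" "b - b'"] by simp
  have l2: "\<bar>L2_norm T u - L2_norm T v\<bar> \<le> L2_norm T (\<lambda>x. u x - v x)"
    by (intro L2_norm_reverse_triangle P1_L2 u v)
  have "\<bar>H1_norm T u - H1_norm T v\<bar>
      \<le> sqrt ((L2_norm T u - L2_norm T v)\<^sup>2 + (H1_seminorm T u - H1_seminorm T v)\<^sup>2)"
    unfolding H1_norm_def by (rule sqrt_sum_squares_reverse_triangle)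
  also have "\<dots> \<le> H1_norm T (\<lambda>x. u x - v x)"
    unfolding H1_norm_def using l2 semi by (intro real_sqrt_le_mono add_mono abs_le_square_iff[THEN iffD1]) auto
  finally show ?thesis using semi by (simp add: elem_norm_def)
qed

context
  fixes \<beta> :: "'a \<Rightarrow> 'a" and B \<sigma> :: real
  assumes \<beta>: "\<beta> \<in> borel_measurable (lebesgue_on T)" and B: "AE x in lebesgue_on T. norm (\<beta> x) \<le> B"
    and B0: "0 \<le> B" and \<sigma>: "0 \<le> \<sigma>"
begin

text \<open>
  The gradient of \<open>w\<close> is almost everywhere a constant vector \<open>a\<close>, so the advective term is dominated by the constant \<open>B \<bar>a\<bar>\<close>,
  whose norm is \<open>B\<close> times the seminorm of \<open>w\<close>.
\<close>
lemma advection_reaction_bound: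
  assumes w: "w \<in> P1 T"
  defines "A \<equiv> \<lambda>x. \<beta> x \<bullet> weak_grad (interior T) w x + \<sigma> * w x"
  shows "A \<in> L2 T" "L2_norm T A \<le> B * H1_seminorm T w + \<sigma> * L2_norm T w"
proof -
  obtain a b where ab: "\<forall>x\<in>T. w x = a \<bullet> x + b" using w unfolding P1_def by blast
  let ?A = "\<lambda>x. \<beta> x \<bullet> a + \<sigma> * w x"
  have ae: "AE x in lebesgue_on T. ?A x = A x"
    using P1_weak_grad[of w a b] ab unfolding A_def by (auto elim: eventually_mono)
  have const: "(\<lambda>x. B *\<^sub>R a) \<in> L2 T" by (intro L2_continuous_compact cT continuous_intros)
  have le: "AE x in lebesgue_on T. norm (\<beta> x \<bullet> a) \<le> norm (B *\<^sub>R a)"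
    using B
  proof eventually_elim
    case (elim x)
    have "norm (\<beta> x \<bullet> a) \<le> norm (\<beta> x) * norm a" using Cauchy_Schwarz_ineq2 by simp
    also have "\<dots> \<le> B * norm a" using elim by (intro mult_right_mono) auto
    finally show ?case using B0 by simp
  qed
  have adv: "(\<lambda>x. \<beta> x \<bullet> a) \<in> L2 T"
  proof (rule L2_dominated[OF _ L2_integrable[OF const]])
    show "(\<lambda>x. \<beta> x \<bullet> a) \<in> borel_measurable (lebesgue_on T)" using \<beta> by measurable
    show "AE x in lebesgue_on T. (norm (\<beta> x \<bullet> a))\<^sup>2 \<le> (norm (B *\<^sub>R a))\<^sup>2"
      using le by eventually_elim (rule power_mono, auto)
  qed
  have reac: "(\<lambda>x. \<sigma> * w x) \<in> L2 T" using L2_scaleR[OF P1_L2[OF w], of \<sigma>] by simp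
  have sum: "?A \<in> L2 T" by (rule L2_add[OF adv reac])
  show "A \<in> L2 T" by (rule L2_cong_AE[OF sum element_measurable ae])
  have "L2_norm T A = L2_norm T ?A"
    by (rule L2_norm_cong_AE[OF L2_measurable[OF sum] element_measurable ae])
  also have "\<dots> \<le> L2_norm T (\<lambda>x. \<beta> x \<bullet> a) + L2_norm T (\<lambda>x. \<sigma> * w x)"
    by (rule L2_norm_triangle[OF adv reac])
  also have "\<dots> \<le> L2_norm T (\<lambda>x. B *\<^sub>R a) + L2_norm T (\<lambda>x. \<sigma> *\<^sub>R w x)"
    using L2_norm_mono[OF const le] by simp
  also have "\<dots> = B * H1_seminorm T w + \<sigma> * L2_norm T w"
    using B0 \<sigma> H1_seminorm_affine[OF cT vT, of w a b] ab by (simp only: L2_norm_scaleR)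
  finally show "L2_norm T A \<le> B * H1_seminorm T w + \<sigma> * L2_norm T w" .
qed

lemma residual_bound:
  assumes f: "f \<in> L2 T" and v: "v \<in> P1 T"
  shows "residual \<beta> \<sigma> f T v \<in> L2 T"
    "L2_norm T (residual \<beta> \<sigma> f T v) \<le> B * H1_seminorm T v + \<sigma> * L2_norm T v + L2_norm T f"
proof -
  note ar = advection_reaction_bound[OF v]
  have eq: "residual \<beta> \<sigma> f T v = (\<lambda>x. (\<beta> x \<bullet> weak_grad (interior T) v x + \<sigma> * v x) - f x)"
    by (simp add: residual_def fun_eq_iff)
  show "residual \<beta> \<sigma> f T v \<in> L2 T" unfolding eq by (rule L2_diff[OF ar(1) f])
  show "L2_norm T (residual \<beta> \<sigma> f T v) \<le> B * H1_seminorm T v + \<sigma> * L2_norm T v + L2_norm T f"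
    unfolding eq using L2_norm_triangle_diff[OF ar(1) f] ar(2) by simp
qed

text \<open>
  The source term cancels in the difference of two residuals and leaves the advection-reaction operator applied to \<open>u - v\<close>.
\<close>
lemma residual_Lipschitz:
  assumes f: "f \<in> L2 T" and u: "u \<in> P1 T" and v: "v \<in> P1 T"
  shows "\<bar>L2_norm T (residual \<beta> \<sigma> f T u) - L2_norm T (residual \<beta> \<sigma> f T v)\<bar>
    \<le> B * H1_seminorm T (\<lambda>x. u x - v x) + \<sigma> * L2_norm T (\<lambda>x. u x - v x)"
proof -
  obtain a b a' b' where ab: "\<forall>x\<in>T. u x = a \<bullet> x + b" and ab': "\<forall>x\<in>T. v x = a' \<bullet> x + b'"
    using u v unfolding P1_def by blast
  let ?w = "\<lambda>x. u x - v x"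
  have d: "\<forall>x\<in>T. ?w x = (a - a') \<bullet> x + (b - b')" using ab ab' by (simp add: inner_diff_left)
  note ar = advection_reaction_bound[OF P1_diff[OF u v]]
  have "AE x in lebesgue_on T. weak_grad (interior T) ?w x = a - a'"
    "AE x in lebesgue_on T. weak_grad (interior T) u x = a" "AE x in lebesgue_on T. weak_grad (interior T) v x = a'"
    by (rule P1_weak_grad; use ab ab' d in blast)+
  then have ae: "AE x in lebesgue_on T. \<beta> x \<bullet> weak_grad (interior T) ?w x + \<sigma> * ?w x
      = residual \<beta> \<sigma> f T u x - residual \<beta> \<sigma> f T v x"
    by eventually_elim (simp add: residual_def inner_diff_right right_diff_distrib)
  have "\<bar>L2_norm T (residual \<beta> \<sigma> f T u) - L2_norm T (residual \<beta> \<sigma> f T v)\<bar>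
      \<le> L2_norm T (\<lambda>x. residual \<beta> \<sigma> f T u x - residual \<beta> \<sigma> f T v x)"
    by (intro L2_norm_reverse_triangle residual_bound(1) f u v)
  also have "\<dots> = L2_norm T (\<lambda>x. \<beta> x \<bullet> weak_grad (interior T) ?w x + \<sigma> * ?w x)"
    by (rule L2_norm_cong_AE[OF L2_measurable[OF ar(1)] element_measurable ae])
  also note ar(2)
  finally show ?thesis .
qed

end

text \<open>
  For \<open>\<sigma> = 0\<close> the constant \<open>a_const\<close> reduces to the norm of \<open>\<beta>\<close> and \<open>elem_norm\<close> to the seminorm, so the estimate in the
  element norm contains both the general and the sharpened estimate.
\<close>
lemma xi_Lipschitz:
  assumes \<beta>: "\<beta> \<in> borel_measurable (lebesgue_on T)"
    and B: "AE x in lebesgue_on T. norm (\<beta> x) \<le> Linfty_norm T \<beta>" "0 \<le> Linfty_norm T \<beta>"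
    and \<sigma>: "0 \<le> \<sigma>" and \<tau>: "0 < \<tau>" and \<mu>: "0 \<le> \<mu> (diameter T)" and f: "f \<in> L2 T"
    and u: "u \<in> P1 T" and v: "v \<in> P1 T"
  shows "\<bar>xi \<epsilon> \<beta> \<sigma> f \<mu> \<tau> T u - xi \<epsilon> \<beta> \<sigma> f \<mu> \<tau> T v\<bar>
    \<le> L_hat \<epsilon> \<beta> \<sigma> f \<mu> \<tau> T * elem_norm \<sigma> T (\<lambda>x. u x - v x)"
proof -
  let ?B = "Linfty_norm T \<beta>" and ?N = "elem_norm \<sigma> T" and ?w = "\<lambda>x. u x - v x"
  let ?R = "\<lambda>v. L2_norm T (residual \<beta> \<sigma> f T v)" and ?q = "q_const \<beta> \<sigma> f \<tau> T" and ?a = "a_const \<beta> \<sigma> T"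
  have a: "?B * H1_seminorm T w + \<sigma> * L2_norm T w \<le> ?a * ?N w" for w
  proof (cases "\<sigma> > 0")
    case True
    then show ?thesis
      using Cauchy_Schwarz_pair[of \<sigma> "L2_norm T w" ?B "H1_seminorm T w"]
      by (simp add: a_const_def elem_norm_def H1_norm_def add.commute)
  next
    case False
    then show ?thesis using \<sigma> B(2) by (simp add: a_const_def elem_norm_def)
  qed
  have sum: "?B * H1_seminorm T w + \<sigma> * L2_norm T w \<le> (?B + \<sigma>) * ?N w" for w
  proof -
    have "H1_seminorm T w \<le> ?N w" by (simp add: elem_norm_def H1_seminorm_le_norm)
    moreover have "\<sigma> * L2_norm T w \<le> \<sigma> * ?N w"
      using \<sigma> L2_norm_le_H1_norm[of T w] by (cases "\<sigma> > 0") (auto simp: elem_norm_def)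
    ultimately show ?thesis using B(2) by (simp add: distrib_right add_mono mult_left_mono)
  qed
  have q0: "0 \<le> ?q" using B \<sigma> \<tau> by (simp add: q_const_def)
  have "?R v \<le> (?B + \<sigma>) * ?N v + L2_norm T f"
    using residual_bound(2)[OF \<beta> B \<sigma> f v] sum[of v] by simp
  also have "\<dots> \<le> ?q * (?N v + \<tau>)"
  proof -
    have "?q * (?N v + \<tau>) = (?B + \<sigma>) * ?N v + L2_norm T f + ((?B + \<sigma>) * \<tau> + L2_norm T f * ?N v / \<tau>)"
      using \<tau> by (simp add: q_const_def field_simps)
    moreover have "0 \<le> (?B + \<sigma>) * \<tau> + L2_norm T f * ?N v / \<tau>" using B \<sigma> \<tau> by simp
    ultimately show ?thesis by linarith
  qed
  finally have Rv: "?R v \<le> ?q * (?N v + \<tau>)" .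
  have "\<bar>?R u / (?N u + \<tau>) - ?R v / (?N v + \<tau>)\<bar> \<le> (?a + ?q) * ?N ?w / \<tau>"
    by (rule quotient_Lipschitz)
      (use residual_Lipschitz[OF \<beta> B \<sigma> f u v] a[of ?w] Rv elem_norm_reverse_triangle[OF u v, of \<sigma>] \<tau> q0 in auto)
  moreover have k: "0 \<le> chi \<epsilon> \<beta> T * \<mu> (diameter T)" using \<mu> by (simp add: chi_def)
  ultimately have "(chi \<epsilon> \<beta> T * \<mu> (diameter T)) * \<bar>?R u / (?N u + \<tau>) - ?R v / (?N v + \<tau>)\<bar>
      \<le> (chi \<epsilon> \<beta> T * \<mu> (diameter T)) * ((?a + ?q) * ?N ?w / \<tau>)"
    by (intro mult_left_mono)
  moreover have "\<bar>xi \<epsilon> \<beta> \<sigma> f \<mu> \<tau> T u - xi \<epsilon> \<beta> \<sigma> f \<mu> \<tau> T v\<bar>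
      = (chi \<epsilon> \<beta> T * \<mu> (diameter T)) * \<bar>?R u / (?N u + \<tau>) - ?R v / (?N v + \<tau>)\<bar>"
    unfolding xi_def right_diff_distrib[symmetric] by (subst abs_mult) (simp only: abs_of_nonneg[OF k])
  ultimately show ?thesis by (simp add: L_hat_def)
qed

end

section \<open>The bubble projection in the energy norms and the constants\<close>

text \<open>
  Stability of the projection is a statement about single functions; it yields Lipschitz estimates only because the
  projection respects differences.
\<close>
lemma kappa_diff:
  fixes \<T> :: "'a::euclidean_space set set"
  assumes \<Omega>: "open \<Omega>" and mesh: "conforming_triangulation \<Omega> \<T>"
    and u: "u \<in> Vhb0 \<Omega> \<T>" and v: "v \<in> Vhb0 \<Omega> \<T>"
  shows "(\<lambda>x. u x - v x) \<in> Vhb0 \<Omega> \<T>"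
    "kappa \<Omega> \<T> (\<lambda>x. u x - v x) = (\<lambda>x. kappa \<Omega> \<T> u x - kappa \<Omega> \<T> v x)"
proof -
  obtain uh ub where u': "uh \<in> Vh0 \<Omega> \<T>" "ub \<in> Vb \<T>" "u = (\<lambda>x. uh x + ub x)" using u by (auto simp: Vhb0_def)
  obtain vh vb where v': "vh \<in> Vh0 \<Omega> \<T>" "vb \<in> Vb \<T>" "v = (\<lambda>x. vh x + vb x)" using v by (auto simp: Vhb0_def)
  note h = Vh0_diff[OF \<Omega> u'(1) v'(1)] and b = Vb_diff[OF u'(2) v'(2)]
  have eq: "(\<lambda>x. u x - v x) = (\<lambda>x. (uh x - vh x) + (ub x - vb x))"
    by (simp add: u' v' fun_eq_iff)
  show "(\<lambda>x. u x - v x) \<in> Vhb0 \<Omega> \<T>"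
    unfolding eq Vhb0_def mem_Collect_eq
    by (intro exI[of _ "\<lambda>x. uh x - vh x"] exI[of _ "\<lambda>x. ub x - vb x"] conjI refl h b)
  show "kappa \<Omega> \<T> (\<lambda>x. u x - v x) = (\<lambda>x. kappa \<Omega> \<T> u x - kappa \<Omega> \<T> v x)"
    unfolding eq kappa_eq[OF mesh h b] unfolding u'(3) v'(3) kappa_eq[OF mesh u'(1,2)] kappa_eq[OF mesh v'(1,2)] ..
qed

lemma kappa_in_Vh0:
  fixes \<T> :: "'a::euclidean_space set set"
  assumes mesh: "conforming_triangulation \<Omega> \<T>" and v: "v \<in> Vhb0 \<Omega> \<T>"
  shows "kappa \<Omega> \<T> v \<in> Vh0 \<Omega> \<T>"
  using v kappa_eq[OF mesh] by (auto simp: Vhb0_def)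

lemma H1_seminorm_kappa_le:
  fixes \<T> :: "'a::euclidean_space set set"
  assumes mesh: "conforming_triangulation \<Omega> \<T>" and T: "T \<in> \<T>" and v: "v \<in> Vhb0 \<Omega> \<T>"
  shows "H1_seminorm T (kappa \<Omega> \<T> v) \<le> H1_seminorm T v"
proof -
  obtain vh vb where v': "vh \<in> Vh0 \<Omega> \<T>" "vb \<in> Vb \<T>" "v = (\<lambda>x. vh x + vb x)" using v by (auto simp: Vhb0_def)
  obtain c where c: "\<And>x. x \<in> T \<Longrightarrow> vb x = c * bubble T x" using Vb_on_element[OF mesh T v'(2)] by metis
  have "H1_seminorm T vh \<le> H1_seminorm T v"
    by (rule H1_seminorm_affine_le_add_bubble[OF conforming_triangulation_simplex[OF mesh T]])
      (use v' T c in \<open>auto simp: Vh0_def\<close>)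
  then show ?thesis using kappa_eq[OF mesh v'(1,2)] v'(3) by simp
qed

lemma H1_norm_kappa_le:
  fixes \<T> :: "'a::euclidean_space set set"
  assumes mesh: "conforming_triangulation \<Omega> \<T>" and T: "T \<in> \<T>" and v: "v \<in> Vhb0 \<Omega> \<T>"
    and C: "L2_norm T (kappa \<Omega> \<T> v) \<le> C * L2_norm T v"
  shows "H1_norm T (kappa \<Omega> \<T> v) \<le> max C 1 * H1_norm T v"
proof -
  have "L2_norm T (kappa \<Omega> \<T> v) \<le> max C 1 * L2_norm T v"
    using C mult_right_mono[of C "max C 1" "L2_norm T v"] by simp
  moreover have "H1_seminorm T (kappa \<Omega> \<T> v) \<le> max C 1 * H1_seminorm T v"
    using H1_seminorm_kappa_le[OF mesh T v] mult_right_mono[of 1 "max C 1" "H1_seminorm T v"] by simp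
  ultimately have "H1_norm T (kappa \<Omega> \<T> v) \<le> sqrt ((max C 1 * L2_norm T v)\<^sup>2 + (max C 1 * H1_seminorm T v)\<^sup>2)"
    unfolding H1_norm_def by (intro real_sqrt_le_mono add_mono power_mono) auto
  also have "\<dots> = max C 1 * H1_norm T v"
    by (simp add: H1_norm_def power_mult_distrib real_sqrt_mult flip: distrib_left)
  finally show ?thesis .
qed

lemma q_const_nonneg:
  "0 \<le> Linfty_norm T \<beta> \<Longrightarrow> 0 \<le> \<sigma> \<Longrightarrow> 0 < \<tau> \<Longrightarrow> 0 \<le> q_const \<beta> \<sigma> f \<tau> T"
  by (simp add: q_const_def)

lemma L_hat_nonneg:
  assumes "0 \<le> Linfty_norm T \<beta>" "0 \<le> \<sigma>" "0 < \<tau>" "0 \<le> \<mu> (diameter T)"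
  shows "0 \<le> L_hat \<epsilon> \<beta> \<sigma> f \<mu> \<tau> T"
  using assms q_const_nonneg[OF assms(1-3), of f] by (simp add: L_hat_def chi_def a_const_def)

text \<open>
  The data enter through norms over one element; global bounds \<open>B\<close> and \<open>F\<close> on them leave \<open>diameter T\<close> as the only
  quantity that depends on the mesh.
\<close>
lemma L_hat_le:
  assumes B: "0 \<le> Linfty_norm T \<beta>" "Linfty_norm T \<beta> \<le> B" and F: "L2_norm T f \<le> F"
    and \<sigma>: "0 \<le> \<sigma>" and \<tau>: "0 < \<tau>" and \<mu>: "0 \<le> \<mu> (diameter T)" "\<mu> (diameter T) \<le> C * diameter T"
  shows "L_hat \<epsilon> \<beta> \<sigma> f \<mu> \<tau> T \<le> (C / \<tau> * (sqrt (B\<^sup>2 + \<sigma>\<^sup>2) + (B + \<sigma> + inverse \<tau> * F))) * diameter T"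
proof -
  have "a_const \<beta> \<sigma> T \<le> sqrt (B\<^sup>2 + \<sigma>\<^sup>2)"
    unfolding a_const_def using B by (intro real_sqrt_le_mono add_right_mono power_mono)
  moreover have "q_const \<beta> \<sigma> f \<tau> T \<le> B + \<sigma> + inverse \<tau> * F"
    unfolding q_const_def using B F \<tau> by (intro add_mono mult_left_mono) auto
  ultimately have K: "a_const \<beta> \<sigma> T + q_const \<beta> \<sigma> f \<tau> T \<le> sqrt (B\<^sup>2 + \<sigma>\<^sup>2) + (B + \<sigma> + inverse \<tau> * F)"
    (is "?s \<le> ?K") by (rule add_mono)
  have s: "0 \<le> ?s" using q_const_nonneg[OF B(1) \<sigma> \<tau>, of f] by (simp add: a_const_def)
  have "chi \<epsilon> \<beta> T * (\<mu> (diameter T) / \<tau>) \<le> C * diameter T / \<tau>"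
  proof -
    have "chi \<epsilon> \<beta> T * (\<mu> (diameter T) / \<tau>) \<le> \<mu> (diameter T) / \<tau>"
      using \<mu> \<tau> by (simp add: chi_def)
    also have "\<dots> \<le> C * diameter T / \<tau>" using \<mu> \<tau> by (intro divide_right_mono) auto
    finally show ?thesis .
  qed
  moreover have "0 \<le> C * diameter T / \<tau>" using \<mu> \<tau> by simp
  ultimately have "L_hat \<epsilon> \<beta> \<sigma> f \<mu> \<tau> T \<le> (C * diameter T / \<tau>) * ?K"
    unfolding L_hat_def using K s by (intro mult_mono) auto
  then show ?thesis by (simp add: mult_ac)
qed

lemma L_zero_eq_L_hat: "0 \<le> Linfty_norm T \<beta> \<Longrightarrow> L_zero \<epsilon> \<beta> 0 f \<mu> \<tau> T = L_hat \<epsilon> \<beta> 0 f \<mu> \<tau> T"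
  by (simp add: L_zero_def L_hat_def a_const_def)

theorem theorem3p5:
  fixes \<Omega> :: "(real ^ 'd) set"
    and \<epsilon> \<sigma> \<tau> C\<^sub>\<mu> C\<^sub>\<kappa> :: real
    and \<beta> :: "real ^ 'd \<Rightarrow> real ^ 'd"
    and f :: "real ^ 'd \<Rightarrow> real"
    and \<mu> :: "real \<Rightarrow> real"
    and \<TT> :: "(real ^ 'd) set set set"
  assumes dim: "CARD('d) = 2 \<or> CARD('d) = 3"
    and domain: "polyhedral_lipschitz_domain \<Omega>"
    and eps: "\<epsilon> > 0"
    and beta: "\<beta> \<in> W1_infty_field \<Omega>"
    and div_free: "AE x in lebesgue_on \<Omega>. weak_divergence \<Omega> \<beta> x = 0"
    and sigma: "\<sigma> \<ge> 0"
    and f: "f \<in> L2 \<Omega>"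
    and meshes: "\<forall>\<T>\<in>\<TT>. conforming_triangulation \<Omega> \<T>"
    and regular: "shape_regular \<TT>"
    and tau: "\<tau> > 0"
    and mu: "\<forall>\<T>\<in>\<TT>. \<forall>T\<in>\<T>. 0 < \<mu> (diameter T) \<and> \<mu> (diameter T) \<le> C\<^sub>\<mu> * diameter T"
    and C\<^sub>\<kappa>_pos: "C\<^sub>\<kappa> > 0"
    and kappa_stable: "\<forall>\<T>\<in>\<TT>. \<forall>v\<in>Vhb0 \<Omega> \<T>. \<forall>T\<in>\<T>. L2_norm T (kappa \<Omega> \<T> v) \<le> C\<^sub>\<kappa> * L2_norm T v"
  shows "(\<forall>\<T>\<in>\<TT>. \<forall>u\<in>Vh0 \<Omega> \<T>. \<forall>v\<in>Vh0 \<Omega> \<T>. \<forall>T\<in>\<T>.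
            \<bar>xi \<epsilon> \<beta> \<sigma> f \<mu> \<tau> T u - xi \<epsilon> \<beta> \<sigma> f \<mu> \<tau> T v\<bar>
              \<le> L_hat \<epsilon> \<beta> \<sigma> f \<mu> \<tau> T * H1_norm T (\<lambda>x. u x - v x))
       \<and> (\<forall>\<T>\<in>\<TT>. \<forall>u\<in>Vhb0 \<Omega> \<T>. \<forall>v\<in>Vhb0 \<Omega> \<T>. \<forall>T\<in>\<T>.
            \<bar>xi \<epsilon> \<beta> \<sigma> f \<mu> \<tau> T (kappa \<Omega> \<T> u) - xi \<epsilon> \<beta> \<sigma> f \<mu> \<tau> T (kappa \<Omega> \<T> v)\<bar>
              \<le> L_kappa \<epsilon> \<beta> \<sigma> f \<mu> \<tau> C\<^sub>\<kappa> T * H1_norm T (\<lambda>x. u x - v x))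
       \<and> (\<forall>\<T>\<in>\<TT>. \<forall>T\<in>\<T>. L_kappa \<epsilon> \<beta> \<sigma> f \<mu> \<tau> C\<^sub>\<kappa> T
            = chi \<epsilon> \<beta> T * (\<mu> (diameter T) / \<tau>) * max C\<^sub>\<kappa> 1 * (a_const \<beta> \<sigma> T + q_const \<beta> \<sigma> f \<tau> T))
       \<and> (\<exists>C\<^sub>L>0. \<forall>\<T>\<in>\<TT>. \<forall>T\<in>\<T>. L_kappa \<epsilon> \<beta> \<sigma> f \<mu> \<tau> C\<^sub>\<kappa> T \<le> C\<^sub>L * diameter T)
       \<and> (\<sigma> = 0 \<longrightarrow>
            (\<forall>\<T>\<in>\<TT>. \<forall>u\<in>Vh0 \<Omega> \<T>. \<forall>v\<in>Vh0 \<Omega> \<T>. \<forall>T\<in>\<T>.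
               \<bar>xi \<epsilon> \<beta> \<sigma> f \<mu> \<tau> T u - xi \<epsilon> \<beta> \<sigma> f \<mu> \<tau> T v\<bar>
                 \<le> L_zero \<epsilon> \<beta> \<sigma> f \<mu> \<tau> T * H1_seminorm T (\<lambda>x. u x - v x))
          \<and> (\<forall>\<T>\<in>\<TT>. \<forall>u\<in>Vhb0 \<Omega> \<T>. \<forall>v\<in>Vhb0 \<Omega> \<T>. \<forall>T\<in>\<T>.
               \<bar>xi \<epsilon> \<beta> \<sigma> f \<mu> \<tau> T (kappa \<Omega> \<T> u) - xi \<epsilon> \<beta> \<sigma> f \<mu> \<tau> T (kappa \<Omega> \<T> v)\<bar>
                 \<le> L_zero \<epsilon> \<beta> \<sigma> f \<mu> \<tau> T * H1_seminorm T (\<lambda>x. u x - v x))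
          \<and> (\<exists>C\<^sub>L>0. \<forall>\<T>\<in>\<TT>. \<forall>T\<in>\<T>. L_zero \<epsilon> \<beta> \<sigma> f \<mu> \<tau> T \<le> C\<^sub>L * diameter T))"
proof -
  have \<Omega>: "open \<Omega>" and \<Omega>s: "\<Omega> \<in> sets lebesgue" and bdry: "negligible (frontier \<Omega>)"
    using domain negligible_polyhedral_boundary by (auto simp: polyhedral_lipschitz_domain_def)
  obtain B where B: "AE x in lebesgue_on \<Omega>. norm (\<beta> x) \<le> B"
    using W1_infty_field_bounded(2)[OF beta] by blast
  \<comment> \<open>All that the estimates use about one element, with bounds that do not depend on the mesh.\<close>
  have element: "compact T \<and> convex T \<and> \<beta> \<in> borel_measurable (lebesgue_on T) \<and>
      (AE x in lebesgue_on T. norm (\<beta> x) \<le> Linfty_norm T \<beta>) \<and> 0 \<le> Linfty_norm T \<beta> \<and> Linfty_norm T \<beta> \<le> B \<and>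
      f \<in> L2 T \<and> L2_norm T f \<le> L2_norm \<Omega> f \<and> 0 \<le> \<mu> (diameter T) \<and> \<mu> (diameter T) \<le> C\<^sub>\<mu> * diameter T"
    if mT: "\<T> \<in> \<TT>" "T \<in> \<T>" for \<T> T
  proof -
    have mesh: "conforming_triangulation \<Omega> \<T>" using meshes mT by blast
    note spx = conforming_triangulation_simplex[OF mesh mT(2)]
    note cc = simplex_compact_convex[OF spx]
    have Ts: "T \<in> sets lebesgue" by (rule element_measurable[OF cc])
    have "T \<subseteq> closure \<Omega>" using mesh mT by (auto simp: conforming_triangulation_def)
    then have "T - \<Omega> \<subseteq> frontier \<Omega>" using \<Omega> by (auto simp: frontier_def interior_open)
    then have neg: "negligible (T - \<Omega>)" using bdry negligible_subset by blast
    have \<beta>: "\<beta> \<in> borel_measurable (lebesgue_on T)"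
      by (rule borel_measurable_lebesgue_on_transfer[OF W1_infty_field_bounded(1)[OF beta] Ts neg])
    note inf = Linfty_norm_bounds[OF Ts interior_simplex_nonempty[OF spx] \<beta> AE_lebesgue_on_transfer[OF B \<Omega>s Ts neg]]
    show ?thesis
      using cc \<beta> inf L2_transfer[OF f \<Omega>s Ts neg] mu mT by (simp add: less_imp_le)
  qed
  have P1: "v \<in> P1 T" if "v \<in> Vh0 \<Omega> \<T>" "T \<in> \<T>" for v T \<T> using that by (simp add: Vh0_def)
  have lip: "\<bar>xi \<epsilon> \<beta> \<sigma> f \<mu> \<tau> T u - xi \<epsilon> \<beta> \<sigma> f \<mu> \<tau> T v\<bar>
      \<le> L_hat \<epsilon> \<beta> \<sigma> f \<mu> \<tau> T * elem_norm \<sigma> T (\<lambda>x. u x - v x)"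
    if "\<T> \<in> \<TT>" "T \<in> \<T>" "u \<in> Vh0 \<Omega> \<T>" "v \<in> Vh0 \<Omega> \<T>" for \<T> T u v
    using element[OF that(1,2)] P1 that by (intro xi_Lipschitz sigma tau) blast+
  have L0: "0 \<le> L_hat \<epsilon> \<beta> \<sigma> f \<mu> \<tau> T" if "\<T> \<in> \<TT>" "T \<in> \<T>" for \<T> T
    using element[OF that] sigma tau by (intro L_hat_nonneg) auto
  have lip_kappa: "\<bar>xi \<epsilon> \<beta> \<sigma> f \<mu> \<tau> T (kappa \<Omega> \<T> u) - xi \<epsilon> \<beta> \<sigma> f \<mu> \<tau> T (kappa \<Omega> \<T> v)\<bar>
      \<le> L_hat \<epsilon> \<beta> \<sigma> f \<mu> \<tau> T * elem_norm \<sigma> T (kappa \<Omega> \<T> (\<lambda>x. u x - v x))"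
    and Vhb0: "(\<lambda>x. u x - v x) \<in> Vhb0 \<Omega> \<T>"
    if m: "\<T> \<in> \<TT>" "T \<in> \<T>" "u \<in> Vhb0 \<Omega> \<T>" "v \<in> Vhb0 \<Omega> \<T>" for \<T> T u v
  proof -
    have mesh: "conforming_triangulation \<Omega> \<T>" using meshes m by blast
    show "(\<lambda>x. u x - v x) \<in> Vhb0 \<Omega> \<T>" by (rule kappa_diff(1)[OF \<Omega> mesh m(3,4)])
    show "\<bar>xi \<epsilon> \<beta> \<sigma> f \<mu> \<tau> T (kappa \<Omega> \<T> u) - xi \<epsilon> \<beta> \<sigma> f \<mu> \<tau> T (kappa \<Omega> \<T> v)\<bar>
      \<le> L_hat \<epsilon> \<beta> \<sigma> f \<mu> \<tau> T * elem_norm \<sigma> T (kappa \<Omega> \<T> (\<lambda>x. u x - v x))"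
      unfolding kappa_diff(2)[OF \<Omega> mesh m(3,4)]
      by (rule lip[OF m(1,2) kappa_in_Vh0[OF mesh m(3)] kappa_in_Vh0[OF mesh m(4)]])
  qed
  have part1: "\<bar>xi \<epsilon> \<beta> \<sigma> f \<mu> \<tau> T u - xi \<epsilon> \<beta> \<sigma> f \<mu> \<tau> T v\<bar>
      \<le> L_hat \<epsilon> \<beta> \<sigma> f \<mu> \<tau> T * H1_norm T (\<lambda>x. u x - v x)"
    if "\<T> \<in> \<TT>" "T \<in> \<T>" "u \<in> Vh0 \<Omega> \<T>" "v \<in> Vh0 \<Omega> \<T>" for \<T> T u v
    by (rule order_trans[OF lip[OF that] mult_left_mono[OF elem_norm_le_H1_norm L0[OF that(1,2)]]])
  have part2: "\<bar>xi \<epsilon> \<beta> \<sigma> f \<mu> \<tau> T (kappa \<Omega> \<T> u) - xi \<epsilon> \<beta> \<sigma> f \<mu> \<tau> T (kappa \<Omega> \<T> v)\<bar>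
      \<le> L_kappa \<epsilon> \<beta> \<sigma> f \<mu> \<tau> C\<^sub>\<kappa> T * H1_norm T (\<lambda>x. u x - v x)"
    if m: "\<T> \<in> \<TT>" "T \<in> \<T>" "u \<in> Vhb0 \<Omega> \<T>" "v \<in> Vhb0 \<Omega> \<T>" for \<T> T u v
  proof -
    have mesh: "conforming_triangulation \<Omega> \<T>" using meshes m by blast
    let ?w = "\<lambda>x. u x - v x"
    have "L2_norm T (kappa \<Omega> \<T> ?w) \<le> C\<^sub>\<kappa> * L2_norm T ?w"
      using kappa_stable m Vhb0[OF m] by blast
    from H1_norm_kappa_le[OF mesh m(2) Vhb0[OF m] this]
    have "elem_norm \<sigma> T (kappa \<Omega> \<T> ?w) \<le> max C\<^sub>\<kappa> 1 * H1_norm T ?w"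
      by (rule order_trans[OF elem_norm_le_H1_norm])
    from order_trans[OF lip_kappa[OF m] mult_left_mono[OF this L0[OF m(1,2)]]]
    show ?thesis by (simp add: L_kappa_def mult_ac)
  qed
  have L_zero: "L_zero \<epsilon> \<beta> \<sigma> f \<mu> \<tau> T = L_hat \<epsilon> \<beta> \<sigma> f \<mu> \<tau> T"
    if "\<T> \<in> \<TT>" "T \<in> \<T>" "\<sigma> = 0" for \<T> T
    using element[OF that(1,2)] that(3) by (simp add: L_zero_eq_L_hat)
  have part5: "\<bar>xi \<epsilon> \<beta> \<sigma> f \<mu> \<tau> T u - xi \<epsilon> \<beta> \<sigma> f \<mu> \<tau> T v\<bar>
      \<le> L_zero \<epsilon> \<beta> \<sigma> f \<mu> \<tau> T * H1_seminorm T (\<lambda>x. u x - v x)"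
    if "\<T> \<in> \<TT>" "T \<in> \<T>" "u \<in> Vh0 \<Omega> \<T>" "v \<in> Vh0 \<Omega> \<T>" "\<sigma> = 0" for \<T> T u v
    using lip[OF that(1-4)] L_zero[OF that(1,2,5)] that(5) by (simp add: elem_norm_def)
  have part6: "\<bar>xi \<epsilon> \<beta> \<sigma> f \<mu> \<tau> T (kappa \<Omega> \<T> u) - xi \<epsilon> \<beta> \<sigma> f \<mu> \<tau> T (kappa \<Omega> \<T> v)\<bar>
      \<le> L_zero \<epsilon> \<beta> \<sigma> f \<mu> \<tau> T * H1_seminorm T (\<lambda>x. u x - v x)"
    if m: "\<T> \<in> \<TT>" "T \<in> \<T>" "u \<in> Vhb0 \<Omega> \<T>" "v \<in> Vhb0 \<Omega> \<T>" and s: "\<sigma> = 0" for \<T> T u v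
  proof -
    have mesh: "conforming_triangulation \<Omega> \<T>" using meshes m by blast
    have "elem_norm \<sigma> T (kappa \<Omega> \<T> (\<lambda>x. u x - v x)) \<le> H1_seminorm T (\<lambda>x. u x - v x)"
      using H1_seminorm_kappa_le[OF mesh m(2) Vhb0[OF m]] s by (simp add: elem_norm_def)
    from order_trans[OF lip_kappa[OF m] mult_left_mono[OF this L0[OF m(1,2)]]]
    show ?thesis unfolding L_zero[OF m(1,2) s] .
  qed
  define K where "K = C\<^sub>\<mu> / \<tau> * (sqrt (B\<^sup>2 + \<sigma>\<^sup>2) + (B + \<sigma> + inverse \<tau> * L2_norm \<Omega> f))"
  \<comment> \<open>\<open>K\<close> may be zero, and \<open>C\<^sub>\<mu>\<close> may be negative if the family of meshes is empty.\<close>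
  define C\<^sub>L where "C\<^sub>L = max C\<^sub>\<kappa> 1 * \<bar>K\<bar> + 1"
  have CL: "C\<^sub>L > 0" by (simp add: C\<^sub>L_def add_nonneg_pos)
  have part4: "L_kappa \<epsilon> \<beta> \<sigma> f \<mu> \<tau> C\<^sub>\<kappa> T \<le> C\<^sub>L * diameter T" if m: "\<T> \<in> \<TT>" "T \<in> \<T>" for \<T> T
  proof -
    have d: "0 \<le> diameter T"
      using element[OF m] by (intro diameter_ge_0 compact_imp_bounded) blast
    have "L_hat \<epsilon> \<beta> \<sigma> f \<mu> \<tau> T \<le> K * diameter T"
      unfolding K_def using element[OF m] sigma tau by (intro L_hat_le) auto
    also have "\<dots> \<le> \<bar>K\<bar> * diameter T" using d by (intro mult_right_mono) auto
    finally have "L_kappa \<epsilon> \<beta> \<sigma> f \<mu> \<tau> C\<^sub>\<kappa> T \<le> max C\<^sub>\<kappa> 1 * (\<bar>K\<bar> * diameter T)"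
      unfolding L_kappa_def by (intro mult_left_mono) auto
    then show ?thesis using d by (simp add: C\<^sub>L_def algebra_simps)
  qed
  have part7: "L_zero \<epsilon> \<beta> \<sigma> f \<mu> \<tau> T \<le> C\<^sub>L * diameter T" if m: "\<T> \<in> \<TT>" "T \<in> \<T>" and s: "\<sigma> = 0" for \<T> T
  proof -
    have "L_zero \<epsilon> \<beta> \<sigma> f \<mu> \<tau> T = L_hat \<epsilon> \<beta> \<sigma> f \<mu> \<tau> T"
      by (rule L_zero[OF m s])
    also have "\<dots> \<le> L_kappa \<epsilon> \<beta> \<sigma> f \<mu> \<tau> C\<^sub>\<kappa> T"
      unfolding L_kappa_def using mult_right_mono[OF max.cobounded2[of 1 C\<^sub>\<kappa>] L0[OF m]] by simp
    finally show ?thesis using part4[OF m] by simp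
  qed
  show ?thesis
  proof (intro conjI impI ballI)
    show "\<exists>C\<^sub>L>0. \<forall>\<T>\<in>\<TT>. \<forall>T\<in>\<T>. L_kappa \<epsilon> \<beta> \<sigma> f \<mu> \<tau> C\<^sub>\<kappa> T \<le> C\<^sub>L * diameter T"
      using CL part4 by blast
    show "\<exists>C\<^sub>L>0. \<forall>\<T>\<in>\<TT>. \<forall>T\<in>\<T>. L_zero \<epsilon> \<beta> \<sigma> f \<mu> \<tau> T \<le> C\<^sub>L * diameter T" if "\<sigma> = 0"
      using CL part7 that by blast
    show "L_kappa \<epsilon> \<beta> \<sigma> f \<mu> \<tau> C\<^sub>\<kappa> T
        = chi \<epsilon> \<beta> T * (\<mu> (diameter T) / \<tau>) * max C\<^sub>\<kappa> 1 * (a_const \<beta> \<sigma> T + q_const \<beta> \<sigma> f \<tau> T)" for T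
      by (simp add: L_kappa_def L_hat_def)
  qed (rule part1 part2 part5 part6; assumption)+
qed

end
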